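(* Let $X$ be a compact Abelian group, let $\mu$ be a Haar measure in $X$, let $(\xi_j)$ be a complete orthonormal system consisting of characters of $X$, let $\mathbf T=(T_j)$ be the sequence of partial sums of the Fourier series with respect to $(\xi_j)$, and let $m>0$. If the maximal operator $M_{\mathbf T}$ belongs to the class $\mathrm{H}_m(X,\mu)$, then the Fourier series with respect to $(\xi_j)$ of every function $f$ from the class $L(\log^{+}L)^m\log^{+}\log^{+}\log^{+}L(X,\mu)$ converges to $f$ almost everywhere.
   Context: Notation. $\log$ denotes $\log_2$, and $\log^{+}u=\max\{\log u,0\}$ for $u>0$, $\log^+0=0$. $L^0(X,\mu)$ is the class of all measurable functions $f:X\to[-\infty,\infty]$, and $L(X,\mu)$ is the class of all integrable ones. $\chi_E$ is the characteristic function of $E\subset X$. The class $L(\log^{+}L)^m\log^{+}\log^{+}\log^{+}L(X,\mu)$ consists of all measurable $f:X\to[-\infty,\infty]$ with $\int_X |f|(\log^{+}|f|)^m\log^{+}\log^{+}\log^{+}|f|\,d\mu<\infty$. Fourier series. $(\xi_j)_{j\ge0}$ is a sequence of characters of $X$ that is a complete orthonormal system in $L^2(X,\mu)$ (so $\mu(X)=1$). For $f\in L(X,\mu)$ the partial sums of its Fourier series are $T_jf=\sum_{i=0}^{j-1}\left(\int_X f\,\overline{\xi_i}\,d\mu\right)\xi_i$, $j\ge 1$ (complex-valued functions); the Fourier series converges to $f$ almost everywhere if $T_jf\to f$ a.e. The maximal operator is $M_{\mathbf T}f(x)=\sup_j|T_jf(x)|$ $(f\in L(X,\mu),\ x\in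 X)$. The class $\mathrm{H}_m$. An operator $T:L(X,\mu)\to L^0(X,\mu)$ is sub-linear if $|T(f+g)|\le |Tf|+|Tg|$ and $|T(cf)|=|c||Tf|$ a.e. for all $f,g\in L(X,\mu)$ and scalars $c$. For $1\le p<\infty$, $T$ is of restricted weak type $p$ with constant $C_p>0$ if $\mu(\{|T\chi_E|>\lambda\})\le C_p\lambda^{-p}\mu(E)$ for every measurable $E\subset X$ with finite measure and every $\lambda>0$. $\mathrm{H}_m(X,\mu)$ is the class of all sub-linear operators $T:L(X,\mu)\to L^0(X,\mu)$ for which there are $r=r(T)>1$ and $C=C(T)>0$ such that for every $p\in(1,r)$, $T$ is of restricted weak type $p$ with a constant $C_p$ satisfying $C_p\le\left(\frac{C}{p-1}\right)^{mp}$. *)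

theory Defs
  imports "HOL-Analysis.Analysis"
begin

text \<open>A Haar measure is a nonzero translation-invariant Radon measure on the Borel sets.\<close>

definition haar_measure :: "'a::{topological_ab_group_add, t2_space} measure \<Rightarrow> bool" where
  "haar_measure M \<longleftrightarrow>
     sets M = sets borel \<and>
     emeasure M UNIV \<noteq> 0 \<and>
     (\<forall>a. \<forall>B\<in>sets borel. emeasure M ((\<lambda>x. a + x) ` B) = emeasure M B) \<and>
     (\<forall>K. compact K \<longrightarrow> emeasure M K < \<infinity>) \<and>
     (\<forall>B\<in>sets borel. emeasure M B = (INF U\<in>{U. open U \<and> B \<subseteq> U}. emeasure M U)) \<and>
     (\<forall>U. open U \<longrightarrow> emeasure M U = (SUP K\<in>{K. compact K \<and> K \<subseteq> U}. emeasure M K))"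

definition group_character :: "('a::topological_ab_group_add \<Rightarrow> complex) \<Rightarrow> bool" where
  "group_character \<phi> \<longleftrightarrow>
     continuous_on UNIV \<phi> \<and> (\<forall>x. cmod (\<phi> x) = 1) \<and> (\<forall>x y. \<phi> (x + y) = \<phi> x * \<phi> y)"

definition square_integrable :: "'a measure \<Rightarrow> ('a \<Rightarrow> complex) \<Rightarrow> bool" where
  "square_integrable M f \<longleftrightarrow> f \<in> borel_measurable M \<and> integrable M (\<lambda>x. (cmod (f x))\<^sup>2)"

definition orthonormal_system :: "'a measure \<Rightarrow> (nat \<Rightarrow> 'a \<Rightarrow> complex) \<Rightarrow> bool" where
  "orthonormal_system M \<xi> \<longleftrightarrow>
     (\<forall>i. square_integrable M (\<xi> i)) \<and>
     (\<forall>i j. (\<integral>x. \<xi> i x * cnj (\<xi> j x) \<partial>M) = (if i = j then 1 else 0))"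

definition complete_orthonormal_system :: "'a measure \<Rightarrow> (nat \<Rightarrow> 'a \<Rightarrow> complex) \<Rightarrow> bool" where
  "complete_orthonormal_system M \<xi> \<longleftrightarrow>
     orthonormal_system M \<xi> \<and>
     (\<forall>f. square_integrable M f \<and> (\<forall>i. (\<integral>x. f x * cnj (\<xi> i x) \<partial>M) = 0)
          \<longrightarrow> (AE x in M. f x = 0))"

definition L0_class :: "'a measure \<Rightarrow> ('a \<Rightarrow> ereal) set" where
  "L0_class M = borel_measurable M"

definition L_class :: "'a measure \<Rightarrow> ('a \<Rightarrow> ereal) set" where
  "L_class M = {f \<in> borel_measurable M. (\<integral>\<^sup>+x. e2ennreal \<bar>f x\<bar> \<partial>M) < \<infinity>}"

definition log_plus :: "real \<Rightarrow> real" where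
  "log_plus u = (if u > 0 then max (log 2 u) 0 else 0)"

text \<open>The integrand of the Orlicz-type class as a function of \<open>u = |f| \<in> [0, \<infinity>]\<close>, with the
  value \<open>\<infinity>\<close> at \<open>u = \<infinity>\<close>.\<close>

definition LlogL_integrand :: "real \<Rightarrow> ereal \<Rightarrow> ennreal" where
  "LlogL_integrand m u =
     (if u = \<infinity> then \<infinity>
      else let t = real_of_ereal u
           in ennreal (t * log_plus t powr m * log_plus (log_plus (log_plus t))))"

definition LlogL_logloglogL_class :: "real \<Rightarrow> 'a measure \<Rightarrow> ('a \<Rightarrow> ereal) set" where
  "LlogL_logloglogL_class m M =
     {f \<in> borel_measurable M. (\<integral>\<^sup>+x. LlogL_integrand m \<bar>f x\<bar> \<partial>M) < \<infinity>}"

text \<open>Integrable functions are finite almost everywhere, so neither \<open>real_of_ereal\<close> in the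
  coefficients nor the library's value of \<open>\<infinity> + (- \<infinity>)\<close> in \<open>f + g\<close> below matters
  outside a null set.\<close>

definition fourier_coeff :: "'a measure \<Rightarrow> (nat \<Rightarrow> 'a \<Rightarrow> complex) \<Rightarrow> ('a \<Rightarrow> ereal) \<Rightarrow> nat \<Rightarrow> complex" where
  "fourier_coeff M \<xi> f i = (\<integral>x. of_real (real_of_ereal (f x)) * cnj (\<xi> i x) \<partial>M)"

definition fourier_partial_sum ::
  "'a measure \<Rightarrow> (nat \<Rightarrow> 'a \<Rightarrow> complex) \<Rightarrow> nat \<Rightarrow> ('a \<Rightarrow> ereal) \<Rightarrow> 'a \<Rightarrow> complex" where
  "fourier_partial_sum M \<xi> j f x = (\<Sum>i<j. fourier_coeff M \<xi> f i * \<xi> i x)"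

definition fourier_maximal ::
  "'a measure \<Rightarrow> (nat \<Rightarrow> 'a \<Rightarrow> complex) \<Rightarrow> ('a \<Rightarrow> ereal) \<Rightarrow> 'a \<Rightarrow> ereal" where
  "fourier_maximal M \<xi> f x = (SUP j\<in>{1..}. ereal (cmod (fourier_partial_sum M \<xi> j f x)))"

definition fourier_converges_ae ::
  "'a measure \<Rightarrow> (nat \<Rightarrow> 'a \<Rightarrow> complex) \<Rightarrow> ('a \<Rightarrow> ereal) \<Rightarrow> bool" where
  "fourier_converges_ae M \<xi> f \<longleftrightarrow>
     (AE x in M. \<bar>f x\<bar> \<noteq> \<infinity> \<and>
        (\<lambda>j. fourier_partial_sum M \<xi> j f x) \<longlonglongrightarrow> of_real (real_of_ereal (f x)))"

text \<open>Operators \<open>L(X,\<mu>) \<rightarrow> L\<^sup>0(X,\<mu>)\<close> are represented by total functions of which only the values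
  on \<open>L_class M\<close> are constrained.\<close>

definition sublinear_operator :: "'a measure \<Rightarrow> (('a \<Rightarrow> ereal) \<Rightarrow> 'a \<Rightarrow> ereal) \<Rightarrow> bool" where
  "sublinear_operator M T \<longleftrightarrow>
     (\<forall>f\<in>L_class M. T f \<in> L0_class M) \<and>
     (\<forall>f\<in>L_class M. \<forall>g\<in>L_class M.
        AE x in M. \<bar>T (\<lambda>y. f y + g y) x\<bar> \<le> \<bar>T f x\<bar> + \<bar>T g x\<bar>) \<and>
     (\<forall>f\<in>L_class M. \<forall>c::real.
        AE x in M. \<bar>T (\<lambda>y. ereal c * f y) x\<bar> = ereal \<bar>c\<bar> * \<bar>T f x\<bar>)"

definition restricted_weak_type ::
  "'a measure \<Rightarrow> (('a \<Rightarrow> ereal) \<Rightarrow> 'a \<Rightarrow> ereal) \<Rightarrow> real \<Rightarrow> real \<Rightarrow> bool" where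
  "restricted_weak_type M T p K \<longleftrightarrow>
     (\<forall>E\<in>sets M. emeasure M E < \<infinity> \<longrightarrow> (\<forall>t>0.
        emeasure M {x \<in> space M. \<bar>T (indicator E) x\<bar> > ereal t}
          \<le> ennreal (K * t powr (- p)) * emeasure M E))"

definition H_class :: "real \<Rightarrow> 'a measure \<Rightarrow> (('a \<Rightarrow> ereal) \<Rightarrow> 'a \<Rightarrow> ereal) set" where
  "H_class m M =
     {T. sublinear_operator M T \<and>
         (\<exists>r>1. \<exists>C>0. \<forall>p. 1 < p \<and> p < r \<longrightarrow>
            (\<exists>K>0. restricted_weak_type M T p K \<and> K \<le> (C / (p - 1)) powr (m * p)))}"

end

theory Submission
  imports Defs
begin

text \<open>
  Characters have modulus one and the measure has no atoms, so a function with values in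
  \<open>[0, A]\<close> has, up to a small error, the same first Fourier coefficients as \<open>A\<close> times an
  indicator. Hence the restricted weak type estimates of the maximal operator extend to
  \<open>0 \<le> f \<le> A\<close>. A general \<open>f \<ge> 0\<close> is cut along the doubly exponential levels
  \<open>2\<^bsup>2^k\<^esup>\<close>; on the \<open>k\<close>-th piece the exponent \<open>p = 1 + \<delta> / 2\<^sup>k\<close> turns the estimate
  into a weak type 1 bound with constant of order \<open>2\<^bsup>km\<^esup>\<close>. Summing weak type 1 functions costs a
  further factor of order \<open>log k\<close> (Stein and Weiss), which is where the triple logarithm comes
  from. The resulting maximal inequality is linear in the weighted integral of \<open>f\<close>; since
  partial sums of bounded functions are eventually reproduced by the expansion and converge in
  \<open>L\<^sup>2\<close>, it yields convergence almost everywhere.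
\<close>

subsection \<open>Sums of functions of weak type 1\<close>

text \<open>The hypothesis gives bounds only for p > 1, with constants that may explode as p tends
  to 1. On functions of height A the estimate loses A ^ (p - 1), so p - 1 of order 1 / log A keeps
  this loss bounded while the constant becomes of order (log A) ^ m. Along doubly exponential
  heights log A merely doubles from piece to piece, so one exponent serves a whole piece. Weak L1 is
  not normable, and a countable sum of weak type 1 functions is not controlled by the sum of their
  bounds without a logarithmic loss. The pieces are numbered by log log of the height, which makes
  this loss a third logarithm. The final inequality is not homogeneous: its constant depends on the
  threshold s, and the weight on the size of the function. This is harmless because s is fixed
  before the approximation is chosen. The weight is at least 1, whereas the integrand of the class
  vanishes for small values; finiteness of the measure makes up for the difference.\<close>

lemma level_set_truncation:
  fixes g :: ennreal and l :: real
  assumes "g \<le> ennreal l" "l > 0"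
  shows "g \<le> ennreal (l / 2 ^ J) + (\<Sum>j<J. ennreal (l / 2 ^ j) * indicator {y. y > ennreal (l / 2 ^ Suc j)} g)"
proof (induction J)
  case 0
  then show ?case using assms by simp
next
  case (Suc J)
  \<comment> \<open>Either the remainder l / 2 ^ J becomes the new layer, or g is so small that the
    new remainder alone dominates it.\<close>
  show ?case
  proof (cases "g > ennreal (l / 2 ^ Suc J)")
    case True
    have "g \<le> ennreal (l / 2 ^ J) + (\<Sum>j<J. ennreal (l / 2 ^ j) * indicator {y. y > ennreal (l / 2 ^ Suc j)} g)"
      by (rule Suc)
    also have "\<dots> = (\<Sum>j<Suc J. ennreal (l / 2 ^ j) * indicator {y. y > ennreal (l / 2 ^ Suc j)} g)"
      using True by (simp add: add.commute)
    also have "\<dots> \<le> ennreal (l / 2 ^ Suc J) + \<dots>" by (rule add_increasing) simp_all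
    finally show ?thesis .
  next
    case False
    then have "g \<le> ennreal (l / 2 ^ Suc J) + 0" by simp
    also have "\<dots> \<le> ennreal (l / 2 ^ Suc J)
        + (\<Sum>j<Suc J. ennreal (l / 2 ^ j) * indicator {y. y > ennreal (l / 2 ^ Suc j)} g)"
      by (intro add_left_mono) simp
    finally show ?thesis .
  qed
qed

text \<open>Stein-Weiss: values of \<open>g k\<close> above l go into an exceptional set, values
  below l / 2 ^ J k add up pointwise to at most l, and only the J k dyadic layers between are
  integrated, each costing 2 B k. Hence the factor 1 + 2 J k, and hence weak type estimates are
  required at finitely many levels per k only. The threshold 2 l is l for the small values plus l
  for the layers.\<close>

lemma weak_type_suminf:
  fixes g :: "nat \<Rightarrow> 'a \<Rightarrow> ennreal" and B :: "nat \<Rightarrow> ennreal" and J :: "nat \<Rightarrow> nat" and l :: real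
  assumes l: "l > 0"
    and g [measurable]: "\<And>k. g k \<in> borel_measurable M"
    and weak: "\<And>k j. j \<le> J k \<Longrightarrow>
      emeasure M {x \<in> space M. g k x > ennreal (l / 2 ^ j)} \<le> ennreal (2 ^ j / l) * B k"
    and J: "(\<Sum>k. ennreal (1 / 2 ^ J k)) \<le> 1"
  shows "emeasure M {x \<in> space M. (\<Sum>k. g k x) > ennreal (2 * l)}
    \<le> ennreal (1 / l) * (\<Sum>k. ennreal (1 + 2 * real (J k)) * B k)"
proof -
  define H where "H x = (\<Sum>k. \<Sum>j<J k. ennreal (l / 2 ^ j) * indicator {y. y > ennreal (l / 2 ^ Suc j)} (g k x))" for x
  have [measurable]: "H \<in> borel_measurable M" unfolding H_def by measurable
  define Z where "Z = (\<Union>k. {x \<in> space M. g k x > ennreal l})"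
  have [measurable]: "Z \<in> sets M" unfolding Z_def by measurable
  have sub: "{x \<in> space M. (\<Sum>k. g k x) > ennreal (2 * l)} \<subseteq> Z \<union> {x \<in> space M. 1 \<le> ennreal (1 / l) * H x}"
  proof
    fix x assume x: "x \<in> {x \<in> space M. (\<Sum>k. g k x) > ennreal (2 * l)}"
    show "x \<in> Z \<union> {x \<in> space M. 1 \<le> ennreal (1 / l) * H x}"
    proof (cases "x \<in> Z")
      case False
      then have *: "g k x \<le> ennreal l" for k using x by (auto simp: Z_def not_less)
      have "(\<Sum>k. g k x) \<le> (\<Sum>k. ennreal (l / 2 ^ J k)
          + (\<Sum>j<J k. ennreal (l / 2 ^ j) * indicator {y. y > ennreal (l / 2 ^ Suc j)} (g k x)))"
        by (intro suminf_le level_set_truncation * l) auto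
      also have "\<dots> = (\<Sum>k. ennreal (l / 2 ^ J k)) + H x"
        unfolding H_def by (intro suminf_add[symmetric]) auto
      also have "(\<Sum>k. ennreal (l / 2 ^ J k)) = ennreal l * (\<Sum>k. ennreal (1 / 2 ^ J k))"
        using l by (subst ennreal_suminf_cmult[symmetric]) (simp add: ennreal_mult[symmetric])
      also have "\<dots> + H x \<le> ennreal l * 1 + H x"
        by (intro add_right_mono mult_left_mono J) simp
      finally have "ennreal (2 * l) < ennreal l + H x" using x by (auto intro: less_le_trans)
      moreover have "ennreal (2 * l) = ennreal l + ennreal l"
        using l by (simp add: ennreal_plus[symmetric] del: ennreal_plus)
      ultimately have "ennreal l < H x" by (metis add_left_mono not_le)
      then have "ennreal (1 / l) * ennreal l \<le> ennreal (1 / l) * H x"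
        by (intro mult_left_mono) auto
      then show ?thesis using x l by (simp add: ennreal_mult[symmetric])
    qed simp
  qed
  have int_H: "(\<integral>\<^sup>+x. H x \<partial>M) \<le> (\<Sum>k. ennreal (2 * real (J k)) * B k)"
  proof -
    have "(\<integral>\<^sup>+x. H x \<partial>M) = (\<Sum>k. \<Sum>j<J k.
        (\<integral>\<^sup>+x. ennreal (l / 2 ^ j) * indicator {y. y > ennreal (l / 2 ^ Suc j)} (g k x) \<partial>M))"
      unfolding H_def by (subst nn_integral_suminf, measurable, subst nn_integral_sum) measurable
    also have "\<dots> = (\<Sum>k. \<Sum>j<J k. (\<integral>\<^sup>+x. ennreal (l / 2 ^ j) *
        indicator {x \<in> space M. g k x > ennreal (l / 2 ^ Suc j)} x \<partial>M))"
      by (intro suminf_cong sum.cong refl nn_integral_cong) (simp split: split_indicator)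
    also have "\<dots> = (\<Sum>k. \<Sum>j<J k. ennreal (l / 2 ^ j) *
        emeasure M {x \<in> space M. g k x > ennreal (l / 2 ^ Suc j)})"
      by (intro suminf_cong sum.cong refl nn_integral_cmult_indicator) measurable
    \<comment> \<open>Layer j uses the level \<open>Suc j\<close>, allowed since j < J k; height
      times bound is then 2 B k for every j.\<close>
    also have "\<dots> \<le> (\<Sum>k. \<Sum>j<J k. ennreal (l / 2 ^ j) * (ennreal (2 ^ Suc j / l) * B k))"
      by (intro suminf_le sum_mono mult_left_mono weak) auto
    also have "\<dots> = (\<Sum>k. \<Sum>j<J k. 2 * B k)"
    proof -
      have "ennreal (l / 2 ^ j) * ennreal (2 ^ Suc j / l) = 2" for j
        using l by (simp add: ennreal_mult[symmetric])
      then show ?thesis by (simp add: mult.assoc[symmetric])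
    qed
    also have "\<dots> = (\<Sum>k. ennreal (2 * real (J k)) * B k)"
      by (simp add: ennreal_mult mult_ac ennreal_of_nat_eq_real_of_nat)
    finally show ?thesis .
  qed
  have "emeasure M {x \<in> space M. (\<Sum>k. g k x) > ennreal (2 * l)}
      \<le> emeasure M (Z \<union> {x \<in> space M. 1 \<le> ennreal (1 / l) * H x})"
    by (intro emeasure_mono sub) measurable
  also have "\<dots> \<le> emeasure M Z + emeasure M {x \<in> space M. 1 \<le> ennreal (1 / l) * H x}"
    by (intro emeasure_subadditive) measurable
  also have "\<dots> \<le> (\<Sum>k. ennreal (1 / l) * B k) + ennreal (1 / l) * (\<Sum>k. ennreal (2 * real (J k)) * B k)"
  proof (rule add_mono)
    have "emeasure M Z \<le> (\<Sum>k. emeasure M {x \<in> space M. g k x > ennreal l})"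
      unfolding Z_def by (intro emeasure_subadditive_countably) auto
    also have "\<dots> \<le> (\<Sum>k. ennreal (1 / l) * B k)"
      using weak[of 0] by (intro suminf_le) auto
    finally show "emeasure M Z \<le> (\<Sum>k. ennreal (1 / l) * B k)" .
    have "emeasure M {x \<in> space M. 1 \<le> ennreal (1 / l) * H x}
        \<le> ennreal (1 / l) * (\<integral>\<^sup>+x. H x * indicator (space M) x \<partial>M)"
      by (rule nn_integral_Markov_inequality) auto
    also have "(\<integral>\<^sup>+x. H x * indicator (space M) x \<partial>M) = (\<integral>\<^sup>+x. H x \<partial>M)"
      by (intro nn_integral_cong) auto
    also have "ennreal (1 / l) * \<dots> \<le> ennreal (1 / l) * (\<Sum>k. ennreal (2 * real (J k)) * B k)"
      by (intro mult_left_mono int_H) simp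
    finally show "emeasure M {x \<in> space M. 1 \<le> ennreal (1 / l) * H x}
      \<le> ennreal (1 / l) * (\<Sum>k. ennreal (2 * real (J k)) * B k)" .
  qed
  also have "(\<Sum>k. ennreal (1 / l) * B k) + ennreal (1 / l) * (\<Sum>k. ennreal (2 * real (J k)) * B k)
      = ennreal (1 / l) * (\<Sum>k. B k + ennreal (2 * real (J k)) * B k)"
    by (simp add: distrib_left suminf_add[symmetric])
  also have "\<dots> = ennreal (1 / l) * (\<Sum>k. ennreal (1 + 2 * real (J k)) * B k)"
    by (simp add: ennreal_plus ring_distribs)
  finally show ?thesis .
qed

subsection \<open>Doubly exponential levels\<close>

text \<open>About log log t; all t \<le> 2 share level 0, so small values need no separate
  case.\<close>

definition level :: "real \<Rightarrow> nat" where
  "level t = (LEAST k. t \<le> 2 ^ (2 ^ k))"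

text \<open>Large enough for 2 ^ depth k to dominate the square of k + 2, so that the truncated
  tails sum to at most 1; only logarithmic in k, which is what becomes the triple logarithm.\<close>

definition depth :: "nat \<Rightarrow> nat" where
  "depth k = nat \<lceil>2 * log 2 (real k + 2)\<rceil>"

text \<open>The price of a value t: the summation factor of \<open>weak_type_suminf\<close> times
  the growth 2 powr (m k) of the weak type constant at level k. Written through levels rather than
  logarithms, it is constant on each piece of the decomposition and, for m \<ge> 0, monotone and at
  least 1.\<close>

definition weight :: "real \<Rightarrow> real \<Rightarrow> real" where
  "weight m t = (1 + 2 * real (depth (level t))) * 2 powr (m * real (level t))"

lemma two_power_powr: "((2::real) ^ k) powr a = 2 powr (real k * a)"
  by (simp only: powr_realpow[symmetric] powr_powr zero_less_numeral)

lemma level_exists: "\<exists>k. (t::real) \<le> 2 ^ (2 ^ k)"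
proof -
  obtain n where "t < 2 ^ n" using real_arch_pow[of 2 t] by auto
  also have "(2::real) ^ n \<le> 2 ^ (2 ^ n)" by (intro power_increasing) (auto simp: less_imp_le)
  finally show ?thesis by (auto intro: less_imp_le)
qed

lemma le_level: "t \<le> 2 ^ (2 ^ level t)"
  unfolding level_def by (rule LeastI_ex[OF level_exists])

lemma level_le_iff: "level t \<le> k \<longleftrightarrow> t \<le> 2 ^ (2 ^ k)"
proof
  assume "level t \<le> k"
  then have "(2::real) ^ (2 ^ level t) \<le> 2 ^ (2 ^ k)" by (intro power_increasing) auto
  then show "t \<le> 2 ^ (2 ^ k)" by (rule order_trans[OF le_level])
qed (auto simp: level_def intro: Least_le)

lemma level_mono: "s \<le> t \<Longrightarrow> level s \<le> level t"
  using le_level[of t] by (simp add: level_le_iff)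

lemma depth_mono: "i \<le> k \<Longrightarrow> depth i \<le> depth k"
  unfolding depth_def by (intro nat_mono ceiling_mono mult_left_mono) auto

lemma weight_mono:
  assumes "m \<ge> 0" "s \<le> t"
  shows "weight m s \<le> weight m t"
  unfolding weight_def
  using level_mono[OF assms(2)] depth_mono[OF level_mono[OF assms(2)]] assms(1)
  by (intro mult_mono powr_mono mult_left_mono) auto

lemma weight_ge_1: "m \<ge> 0 \<Longrightarrow> weight m t \<ge> 1"
proof -
  assume "m \<ge> 0"
  then have "1 * 1 \<le> (1 + 2 * real (depth (level t))) * 2 powr (m * real (level t))"
    by (intro mult_mono ge_one_powr_ge_zero) auto
  then show ?thesis by (simp add: weight_def)
qed

lemma level_measurable [measurable]: "level \<in> measurable borel (count_space UNIV)"
  unfolding level_def by measurable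

lemma weight_measurable [measurable]: "weight m \<in> borel_measurable borel"
  unfolding weight_def by measurable

text \<open>Comparison with the telescoping series of 1 / ((k + 1) (k + 2)).\<close>

lemma suminf_depth: "(\<Sum>k. ennreal (1 / 2 ^ depth k)) \<le> 1"
proof -
  have sums: "(\<lambda>k. 1 / (real k + 1) - 1 / (real (Suc k) + 1)) sums (1 / (real 0 + 1) - 0)"
    by (rule telescope_sums') real_asymp
  have le: "1 / 2 ^ depth k \<le> 1 / (real k + 1) - 1 / (real (Suc k) + 1)" for k
  proof -
    have "2 * log 2 (real k + 2) \<le> depth k"
      unfolding depth_def by linarith
    then have "2 powr (2 * log 2 (real k + 2)) \<le> 2 powr real (depth k)"
      by simp
    moreover have "2 powr (2 * log 2 (real k + 2)) = (real k + 2)\<^sup>2"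
    proof -
      have "2 powr (2 * log 2 (real k + 2)) = (2 powr log 2 (real k + 2)) powr 2"
        by (simp only: powr_powr mult.commute)
      then show ?thesis by simp
    qed
    ultimately have "(real k + 2)\<^sup>2 \<le> 2 ^ depth k" by (simp add: powr_realpow)
    then have "1 / 2 ^ depth k \<le> 1 / (real k + 2)\<^sup>2"
      by (intro divide_left_mono) auto
    also have "\<dots> \<le> 1 / ((real k + 1) * (real k + 2))"
      by (intro divide_left_mono) (auto simp: power2_eq_square)
    also have "\<dots> = 1 / (real k + 1) - 1 / (real (Suc k) + 1)"
      by (simp add: field_simps)
    finally show ?thesis .
  qed
  have "(\<Sum>k. ennreal (1 / 2 ^ depth k)) \<le> (\<Sum>k. ennreal (1 / (real k + 1) - 1 / (real (Suc k) + 1)))"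
    by (intro suminf_le ennreal_leI le) auto
  also have "\<dots> = ennreal 1"
    using sums by (intro suminf_ennreal_eq) (auto simp: field_simps)
  finally show ?thesis by simp
qed

text \<open>Crude, but of the shape needed later: the excess p - 1 will be \<delta> / 2 ^ k, so
  going down j \<le> depth k halvings changes a (p - 1)-th power by a factor of at most 16.\<close>

lemma depth_le: "real (depth k) \<le> 4 * 2 ^ k"
proof -
  have "real (depth k) \<le> 2 * log 2 (real k + 2) + 1"
    unfolding depth_def by simp
  also have "log 2 (real k + 2) \<le> real k + 1"
  proof -
    have "real k + 2 \<le> 2 ^ (k + 1)" by (induction k) auto
    then have "log 2 (real k + 2) \<le> log 2 (2 ^ (k + 1))" by (subst log_le_cancel_iff) auto
    also have "\<dots> = real k + 1" by (subst log_nat_power) auto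
    finally show ?thesis .
  qed
  also have "2 * (real k + 1) + 1 \<le> 4 * 2 ^ k" by (induction k) auto
  finally show ?thesis by simp
qed

section \<open>Comparison of the weight with iterated logarithms\<close>

lemma log_plus_ge: "t > 0 \<Longrightarrow> log 2 t \<le> log_plus t"
  by (simp add: log_plus_def)

lemma log_plus_nonneg [simp]: "log_plus t \<ge> 0"
  by (simp add: log_plus_def)

lemma log_plus_measurable [measurable]: "log_plus \<in> borel_measurable borel"
  unfolding log_plus_def by measurable

text \<open>The cut 16 = 2 ^ (2 ^ 2) puts larger t on level at least 3, where the triple logarithm
  is at least 1. Below it only a constant can be claimed, as the product of logarithms vanishes for
  t \<le> 4.\<close>

lemma weight_le:
  assumes "m > 0"
  obtains C where "C > 0" "\<And>t. t \<le> 16 \<Longrightarrow> weight m t \<le> C"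
    "\<And>t. t > 16 \<Longrightarrow> weight m t \<le> C * (log_plus t powr m * log_plus (log_plus (log_plus t)))"
proof -
  \<comment> \<open>15 = 1 + 2 * 7, where 7 comes from the bound of \<open>depth (Suc k)\<close> by
    7 log k below; 2 powr m pays for passing from level k + 1 to k, and \<open>weight m 16\<close>
    covers t \<le> 16.\<close>
  define C where "C = weight m 16 + 15 * 2 powr m"
  have C: "C > 0" "weight m 16 \<le> C" "15 * 2 powr m \<le> C"
    unfolding C_def using weight_ge_1[of m 16] assms by (auto intro: add_pos_pos)
  show ?thesis
  proof (rule that)
    show "C > 0" by (rule C)
    show "weight m t \<le> C" if "t \<le> 16" for t
      using weight_mono[of m t 16] that assms C by simp
    fix t :: real assume t: "t > 16"
    let ?L = "log_plus t powr m * log_plus (log_plus (log_plus t))"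
    show "weight m t \<le> C * ?L"
    proof -
      \<comment> \<open>One level down, since minimality of \<open>level t\<close> gives t > 2 ^ (2
        ^ k) and thus lower bounds for the iterated logarithms.\<close>
      define k where "k = level t - 1"
      have "\<not> level t \<le> 2" using t by (simp add: level_le_iff)
      then have k: "level t = Suc k" "k \<ge> 2" by (auto simp: k_def)
      have "\<not> level t \<le> k" using k by simp
      then have "t > 2 ^ (2 ^ k)" by (simp add: level_le_iff not_le)
      then have "log 2 t > log 2 (2 ^ (2 ^ k))" using t by (subst log_less_cancel_iff) auto
      then have l1: "log_plus t > 2 ^ k" using log_plus_ge[of t] t by (simp add: log_nat_power)
      moreover have pos: "(2::real) ^ k > 0" by simp
      ultimately have "log 2 (log_plus t) > log 2 (2 ^ k)"
        by (subst log_less_cancel_iff) (auto intro: less_trans[OF pos])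
      then have l2: "log_plus (log_plus t) > real k"
        using log_plus_ge[of "log_plus t"] less_trans[OF pos l1] by (simp add: log_nat_power)
      have "log 2 (log_plus (log_plus t)) \<ge> log 2 (real k)"
        using l2 k by (subst log_le_cancel_iff) auto
      then have l3: "log_plus (log_plus (log_plus t)) \<ge> log 2 (real k)"
        by (rule order_trans[OF _ log_plus_ge]) (use l2 in linarith)
      have k1: "log 2 (real k) \<ge> 1" using k by (subst le_log_iff) auto
      \<comment> \<open>Absorbs the shift in \<open>depth (Suc k)\<close>: 2 * 3 log k, plus 1 from
        the ceiling, is at most 7 log k.\<close>
      have "real (Suc k) + 2 \<le> real k ^ 3"
      proof -
        have "2 * 2 * real k \<le> real k * real k * real k" using k by (intro mult_mono) auto
        then have "4 * real k \<le> real k ^ 3" by (simp add: power3_eq_cube)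
        moreover have "real (Suc k) + 2 \<le> 4 * real k" using k by simp
        ultimately show ?thesis by linarith
      qed
      then have "log 2 (real (Suc k) + 2) \<le> log 2 (real k ^ 3)"
        using k by (subst log_le_cancel_iff) auto
      also have "\<dots> = 3 * log 2 (real k)" using k by (simp add: log_nat_power)
      finally have "real (depth (Suc k)) \<le> 7 * log 2 (real k)"
        using k1 unfolding depth_def by linarith
      then have "weight m t \<le> (15 * log 2 (real k)) * (2 powr m * 2 powr (m * real k))"
        unfolding weight_def k using k1 by (intro mult_mono) (auto simp: powr_add[symmetric] algebra_simps)
      also have "2 powr (m * real k) = (2 ^ k) powr m"
        by (simp only: two_power_powr mult.commute)
      also have "(15 * log 2 (real k)) * (2 powr m * (2 ^ k) powr m)
          \<le> (15 * log_plus (log_plus (log_plus t))) * (2 powr m * log_plus t powr m)"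
        using l3 l1 assms k1 by (intro mult_mono powr_mono2) auto
      also have "\<dots> = 15 * 2 powr m * ?L" by (simp add: mult_ac)
      also have "\<dots> \<le> C * ?L" by (intro mult_right_mono C) simp
      finally show ?thesis .
    qed
  qed
qed

text \<open>Used for L2 errors: t * weight m t is then at most a constant times t + t ^ 2, so L1 and
  L2 norms control the weighted integral.\<close>

lemma weight_le_linear:
  assumes "m > 0"
  obtains C where "C > 0" "\<And>t. t \<ge> 0 \<Longrightarrow> weight m t \<le> C * (1 + t)"
proof -
  obtain C where C: "C > 0" "\<And>t. t \<le> 16 \<Longrightarrow> weight m t \<le> C"
    "\<And>t. t > 16 \<Longrightarrow> weight m t \<le> C * (log_plus t powr m * log_plus (log_plus (log_plus t)))"
    using weight_le[OF assms] by blast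
  have lp: "log_plus u \<le> u" if "u \<ge> 0" for u
  proof (cases "u \<ge> 1")
    case True
    \<comment> \<open>Prepares 2 powr (u - 1) \<ge> 1 + (u - 1) ln 2; here ln 2 \<ge> 1 / 2 is
      enough.\<close>
    have "u \<le> 2 * (1 + (u - 1) * ln 2)"
      using mult_left_mono[of "1/2" "ln 2" "u - 1"] ln2_ge_two_thirds True by simp
    also have "\<dots> \<le> 2 * exp ((u - 1) * ln 2)"
      by (intro mult_left_mono exp_ge_add_one_self) auto
    also have "\<dots> = 2 powr u" by (simp add: powr_def left_diff_distrib exp_diff)
    finally have "u \<le> 2 powr u" .
    then show ?thesis using True by (simp add: log_plus_def log_le_iff less_imp_le)
  qed (use that in \<open>auto simp: log_plus_def\<close>)
  \<comment> \<open>The constant of \<open>ln_powr_bound2\<close> for exponent m + 1; the power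
    beyond m absorbs the triple logarithm, which is at most \<open>log_plus t\<close>.\<close>
  define D where "D = ((m + 1) powr (m + 1)) / ln 2 powr (m + 1)"
  have D: "D > 0" unfolding D_def using assms by (intro divide_pos_pos) auto
  have bd: "log_plus t powr m * log_plus (log_plus (log_plus t)) \<le> D * t" if "t \<ge> 0" for t
  proof (cases "t > 1")
    case True
    have "log_plus t powr m * log_plus (log_plus (log_plus t)) \<le> log_plus t powr m * log_plus t"
      using lp[of "log_plus t"] lp[of "log_plus (log_plus t)"] by (intro mult_left_mono) auto
    also have "\<dots> = log_plus t powr (m + 1)"
      using log_plus_nonneg[of t] by (simp add: powr_add)
    also have "\<dots> = ln t powr (m + 1) / ln 2 powr (m + 1)"
      using True by (simp add: log_plus_def log_def powr_divide)
    also have "\<dots> \<le> ((m + 1) powr (m + 1) * t) / ln 2 powr (m + 1)"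
      using True assms by (intro divide_right_mono ln_powr_bound2) auto
    finally show ?thesis by (simp add: D_def)
  next
    case False
    then have "log_plus t = 0" using that by (auto simp: log_plus_def)
    then show ?thesis using that D by simp
  qed
  show ?thesis
  proof (rule that)
    show "C * (1 + D) > 0" using C(1) D by simp
    fix t :: real assume t: "t \<ge> 0"
    have "weight m t \<le> C * (1 + D * t)"
    proof (cases "t \<le> 16")
      case True
      have "C * 1 \<le> C * (1 + D * t)" using C(1) D t by (intro mult_left_mono) auto
      then show ?thesis using C(2)[OF True] by simp
    next
      case False
      have "C * (log_plus t powr m * log_plus (log_plus (log_plus t))) \<le> C * (1 + D * t)"
        using C(1) bd[OF t] by (intro mult_left_mono) auto
      then show ?thesis using C(3)[of t] False by simp
    qed
    also have "\<dots> \<le> C * ((1 + D) * (1 + t))"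
      using C(1) D t by (intro mult_left_mono) (auto simp: algebra_simps)
    finally show "weight m t \<le> C * (1 + D) * (1 + t)" by (simp add: mult.assoc)
  qed
qed

text \<open>With p - 1 = \<delta> / 2 ^ k all powers of exponent p - 1 stay bounded: the height
  contributes 2 powr \<delta> \<le> 2, the halvings at most 16, the constant 2 at most 2, and 1 / l
  at most itself because l \<le> 1. Together with the plain factor 2 this is 128 / l. Only K grows
  with k, like 2 powr (m k); the exponent 2 m stands for m p with p \<le> 2. The left side is the
  constant of \<open>weak_type_bounded\<close> for A = 2 ^ (2 ^ k) and t = l / 2 ^ j.\<close>

lemma level_constant_bound:
  fixes m C \<delta> K l :: real
  assumes "m > 0" "C > 0" "0 < \<delta>" "\<delta> \<le> 1" "0 < l" "l \<le> 1" "j \<le> depth k"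
    and p: "p = 1 + \<delta> / 2 ^ k"
    and K: "K \<le> (C / (p - 1)) powr (m * p)"
  shows "K * (l / 2 ^ j / (2 * 2 ^ (2 ^ k))) powr (- p) / 2 ^ (2 ^ k)
    \<le> (2 ^ j / l) * (max 1 (C / \<delta>) powr (2 * m) * 2 powr m * 128 / l * 2 powr (m * real k))"
proof -
  define q where "q = \<delta> / 2 ^ k"
  have two_k: "real k \<le> 2 ^ k" using of_nat_less_two_power[of k, where 'a=real] by (rule less_imp_le)
  have k1: "(1::real) \<le> 2 ^ k" by simp
  have q: "0 < q" "q \<le> 1" using assms k1 by (auto simp: q_def field_simps intro: order_trans)
  have p': "p = 1 + q" "p - 1 = q" using p by (auto simp: q_def)
  have mp: "0 \<le> m * p" "m * p \<le> 2 * m" using assms(1) q p' by auto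
  have "(C / q) powr (m * p) = (C / \<delta>) powr (m * p) * (2 ^ k) powr (m * p)"
    using assms by (simp add: q_def powr_mult[symmetric])
  also have "\<dots> \<le> max 1 (C / \<delta>) powr (2 * m) * (2 powr m * 2 powr (m * real k))"
  proof (rule mult_mono)
    have "(C / \<delta>) powr (m * p) \<le> max 1 (C / \<delta>) powr (m * p)"
      using assms(2,3) mp by (intro powr_mono2) auto
    also have "\<dots> \<le> max 1 (C / \<delta>) powr (2 * m)"
      using mp by (intro powr_mono) auto
    finally show "(C / \<delta>) powr (m * p) \<le> max 1 (C / \<delta>) powr (2 * m)" .
    \<comment> \<open>Since k \<le> 2 ^ k, the surplus (2 ^ k) powr (m (p - 1)) is at most 2 powr
      m.\<close>
    have "real k * q \<le> 1"
      using mult_mono[OF two_k \<open>\<delta> \<le> 1\<close>] \<open>0 < \<delta>\<close> by (simp add: q_def field_simps)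
    then have "m * (real k * q) \<le> m * 1" using \<open>m > 0\<close> by (intro mult_left_mono) auto
    then have "real k * (m * p) \<le> m + m * real k" unfolding p'(1) by (simp add: algebra_simps)
    moreover have "((2::real) ^ k) powr (m * p) = 2 powr (real k * (m * p))"
      by (rule two_power_powr)
    ultimately show "((2::real) ^ k) powr (m * p) \<le> 2 powr m * 2 powr (m * real k)"
      by (simp add: powr_add[symmetric])
  qed auto
  finally have K': "K \<le> max 1 (C / \<delta>) powr (2 * m) * (2 powr m * 2 powr (m * real k))"
    using K p' by simp
  have "(2 * 2 ^ (2 ^ k) * (2 ^ j / l)) powr q = 2 powr q * (2 ^ (2 ^ k)) powr q * ((2 ^ j) powr q * (1 / l) powr q)"
    using \<open>l > 0\<close> by (simp add: powr_mult powr_divide)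
  also have "\<dots> \<le> 2 * 2 * (16 * (1 / l))"
  proof (intro mult_mono)
    show "(2::real) powr q \<le> 2" using q powr_mono[of q 1 2] by simp
    have "((2::real) ^ (2 ^ k)) powr q = 2 powr (real (2 ^ k) * q)"
      by (rule two_power_powr)
    also have "\<dots> = 2 powr \<delta>" by (simp add: q_def)
    also have "\<dots> \<le> 2 powr 1" using assms by (intro powr_mono) auto
    finally show "((2::real) ^ (2 ^ k)) powr q \<le> 2" by simp
    have "real j \<le> 4 * 2 ^ k" using \<open>j \<le> depth k\<close> depth_le[of k] by linarith
    then have "real j * \<delta> \<le> 4 * 2 ^ k * 1" using assms by (intro mult_mono) auto
    then have "real j * q \<le> 4" by (simp add: q_def field_simps)
    then have "2 powr (real j * q) \<le> 2 powr 4" by (intro powr_mono) auto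
    then show "((2::real) ^ j) powr q \<le> 16"
      by (simp add: two_power_powr)
    have "(1 / l) powr q \<le> (1 / l) powr 1" using assms q by (intro powr_mono) auto
    then show "(1 / l) powr q \<le> 1 / l" using \<open>l > 0\<close> by simp
  qed (use \<open>l > 0\<close> in auto)
  finally have Q: "(2 * 2 ^ (2 ^ k) * (2 ^ j / l)) powr q \<le> 2 * 2 * (16 * (1 / l))" .
  have "l / 2 ^ j / (2 * 2 ^ (2 ^ k)) > 0" using \<open>l > 0\<close> by simp
  then have "(l / 2 ^ j / (2 * 2 ^ (2 ^ k))) powr (- p) = (2 * 2 ^ (2 ^ k) * (2 ^ j / l)) powr p"
    by (simp add: powr_minus_divide powr_divide powr_mult)
  also have "\<dots> = 2 * 2 ^ (2 ^ k) * (2 ^ j / l) * (2 * 2 ^ (2 ^ k) * (2 ^ j / l)) powr q"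
    using \<open>l > 0\<close> unfolding p'(1) by (subst powr_add) simp
  also have "\<dots> \<le> 2 * 2 ^ (2 ^ k) * (2 ^ j / l) * (2 * 2 * (16 * (1 / l)))"
    by (intro mult_left_mono Q) (use \<open>l > 0\<close> in auto)
  also have "\<dots> = 2 ^ (2 ^ k) * ((2 ^ j / l) * (128 / l))"
    by simp
  finally have P: "(l / 2 ^ j / (2 * 2 ^ (2 ^ k))) powr (- p) \<le> 2 ^ (2 ^ k) * ((2 ^ j / l) * (128 / l))" .
  have "K * (l / 2 ^ j / (2 * 2 ^ (2 ^ k))) powr (- p)
    \<le> (max 1 (C / \<delta>) powr (2 * m) * (2 powr m * 2 powr (m * real k))) * (2 ^ (2 ^ k) * ((2 ^ j / l) * (128 / l)))"
    using \<open>l > 0\<close> by (intro mult_mono K' P) auto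
  then have "K * (l / 2 ^ j / (2 * 2 ^ (2 ^ k))) powr (- p) / 2 ^ (2 ^ k)
    \<le> (max 1 (C / \<delta>) powr (2 * m) * (2 powr m * 2 powr (m * real k))) * (2 ^ (2 ^ k) * ((2 ^ j / l) * (128 / l))) / 2 ^ (2 ^ k)"
    by (rule divide_right_mono) simp
  also have "\<dots> = (2 ^ j / l) * (max 1 (C / \<delta>) powr (2 * m) * 2 powr m * 128 / l * 2 powr (m * real k))"
    by simp
  finally show ?thesis .
qed

subsection \<open>Fourier coefficients and partial sums\<close>

lemma cnj_measurable [measurable]: "cnj \<in> borel_measurable borel"
  by (intro borel_measurable_continuous_onI continuous_intros)

section \<open>Square integrable functions\<close>

lemma (in finite_measure) integrable_square_integrable:
  assumes "square_integrable M f"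
  shows "integrable M f"
proof (rule Bochner_Integration.integrable_bound)
  show "integrable M (\<lambda>x. 1 + (cmod (f x))\<^sup>2)" "f \<in> borel_measurable M"
    using assms by (auto simp: square_integrable_def)
  have "t \<le> 1 + t\<^sup>2" for t :: real
    using zero_le_power2[of "t - 1/2"] by (simp add: power2_eq_square field_simps)
  then have "norm (f x) \<le> norm (1 + (cmod (f x))\<^sup>2)" for x
    by (metis abs_ge_self order_trans real_norm_def)
  then show "AE x in M. norm (f x) \<le> norm (1 + (cmod (f x))\<^sup>2)" by blast
qed

lemma square_integrable_diff:
  assumes "square_integrable M f" "square_integrable M g"
  shows "square_integrable M (\<lambda>x. f x - g x)"
proof -
  have [measurable]: "f \<in> borel_measurable M" "g \<in> borel_measurable M"
    using assms by (auto simp: square_integrable_def)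
  have "(cmod (a - b))\<^sup>2 \<le> 2 * (cmod a)\<^sup>2 + 2 * (cmod b)\<^sup>2" for a b
  proof -
    have "(cmod (a - b))\<^sup>2 \<le> (cmod a + cmod b)\<^sup>2"
      by (intro power_mono norm_triangle_ineq4) auto
    also have "\<dots> \<le> 2 * (cmod a)\<^sup>2 + 2 * (cmod b)\<^sup>2"
      using zero_le_power2[of "cmod a - cmod b"] by (simp add: power2_eq_square algebra_simps)
    finally show ?thesis .
  qed
  note le = this
  have "integrable M (\<lambda>x. (cmod (f x - g x))\<^sup>2)"
  proof (rule Bochner_Integration.integrable_bound)
    show "integrable M (\<lambda>x. 2 * (cmod (f x))\<^sup>2 + 2 * (cmod (g x))\<^sup>2)"
      using assms by (simp add: square_integrable_def)
    show "AE x in M. norm ((cmod (f x - g x))\<^sup>2) \<le> norm (2 * (cmod (f x))\<^sup>2 + 2 * (cmod (g x))\<^sup>2)"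
      using le by (intro AE_I2) (metis abs_ge_self abs_of_nonneg order_trans real_norm_def zero_le_power2)
  qed measurable
  then show ?thesis by (simp add: square_integrable_def)
qed

lemma (in finite_measure) square_integrable_bounded:
  assumes "f \<in> borel_measurable M" "\<And>x. cmod (f x) \<le> B"
  shows "square_integrable M f"
proof -
  have "(cmod (f x))\<^sup>2 \<le> B\<^sup>2" for x using assms(2) by (intro power_mono) auto
  then show ?thesis using assms(1) unfolding square_integrable_def
    by (intro conjI integrable_const_bound[where B="B\<^sup>2"]) auto
qed

section \<open>Coefficients, partial sums and maximal function of a system of characters\<close>

locale haar_fourier =
  fixes M :: "'a::{topological_ab_group_add, t2_space} measure"
    and \<xi> :: "nat \<Rightarrow> 'a \<Rightarrow> complex"
  assumes compact_space: "compact (UNIV :: 'a set)"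
    and haar: "haar_measure M"
    and character: "\<And>j. group_character (\<xi> j)"
    and complete: "complete_orthonormal_system M \<xi>"
begin

lemma sets_M [measurable_cong]: "sets M = sets borel"
  by (rule haar[unfolded haar_measure_def, THEN conjunct1])

lemma emeasure_compact: "compact K \<Longrightarrow> emeasure M K < \<infinity>"
  by (rule haar[unfolded haar_measure_def, THEN conjunct2, THEN conjunct2, THEN conjunct2,
        THEN conjunct1, rule_format])

lemma outer_regular: "B \<in> sets borel \<Longrightarrow> emeasure M B = (INF U\<in>{U. open U \<and> B \<subseteq> U}. emeasure M U)"
  by (rule haar[unfolded haar_measure_def, THEN conjunct2, THEN conjunct2, THEN conjunct2,
        THEN conjunct2, THEN conjunct1, rule_format])

lemma space_M [simp]: "space M = UNIV"
  using sets_eq_imp_space_eq[OF sets_M] by simp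

sublocale finite_measure M
proof
  have "emeasure M UNIV < \<infinity>"
    using compact_space by (rule emeasure_compact)
  then show "emeasure M (space M) \<noteq> \<infinity>" by simp
qed

lemma norm_xi [simp]: "cmod (\<xi> i x) = 1"
  using character by (simp add: group_character_def)

lemma continuous_xi: "continuous_on UNIV (\<xi> i)"
  using character by (simp add: group_character_def)

lemma xi_measurable [measurable]: "\<xi> i \<in> borel_measurable M"
  using borel_measurable_continuous_onI[OF continuous_xi] measurable_cong_sets[OF sets_M refl] by blast

lemma xi_orthonormal: "(\<integral>x. \<xi> i x * cnj (\<xi> j x) \<partial>M) = (if i = j then 1 else 0)"
  using complete by (simp add: complete_orthonormal_system_def orthonormal_system_def)

text \<open>The definition of Haar measure leaves the scale open; it is fixed by
  \<open>\<xi> 0\<close>, which has modulus 1 and L2 norm 1.\<close>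

lemma measure_UNIV [simp]: "measure M UNIV = 1"
proof -
  have "(\<integral>x. \<xi> 0 x * cnj (\<xi> 0 x) \<partial>M) = 1" by (simp add: xi_orthonormal)
  moreover have "\<xi> 0 x * cnj (\<xi> 0 x) = 1" for x
    using norm_xi[of 0 x] by (simp add: complex_norm_square[symmetric])
  ultimately have "complex_of_real (measure M UNIV) = 1" by (simp add: scaleR_conv_of_real)
  then show ?thesis by simp
qed

lemma integrable_mult_xi [intro]:
  assumes "integrable M h"
  shows "integrable M (\<lambda>x. h x * cnj (\<xi> i x))"
proof -
  have [measurable]: "h \<in> borel_measurable M" using assms by simp
  show ?thesis
    by (rule Bochner_Integration.integrable_bound[OF assms]) (auto simp: norm_mult)
qed

text \<open>Taken for complex-valued functions, since remainders b - \<open>psum n b\<close> are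
  complex in general even for real b.\<close>

definition coeff :: "('a \<Rightarrow> complex) \<Rightarrow> nat \<Rightarrow> complex" where
  "coeff h i = (\<integral>x. h x * cnj (\<xi> i x) \<partial>M)"

definition psum :: "nat \<Rightarrow> ('a \<Rightarrow> complex) \<Rightarrow> 'a \<Rightarrow> complex" where
  "psum j h x = (\<Sum>i<j. coeff h i * \<xi> i x)"

text \<open>Values in \<open>ennreal\<close> allow countable sums without convergence conditions.
  The empty sum at j = 0 is included and contributes 0.\<close>

definition maxop :: "('a \<Rightarrow> complex) \<Rightarrow> 'a \<Rightarrow> ennreal" where
  "maxop h x = (SUP j. ennreal (cmod (psum j h x)))"

lemma psum_measurable [measurable]: "psum j h \<in> borel_measurable M"
  unfolding psum_def by measurable

lemma maxop_measurable [measurable]: "maxop h \<in> borel_measurable M"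
  unfolding maxop_def by measurable

lemma coeff_add:
  "integrable M f \<Longrightarrow> integrable M g \<Longrightarrow> coeff (\<lambda>x. f x + g x) i = coeff f i + coeff g i"
  unfolding coeff_def by (simp add: integrable_mult_xi ring_distribs)

lemma coeff_diff:
  "integrable M f \<Longrightarrow> integrable M g \<Longrightarrow> coeff (\<lambda>x. f x - g x) i = coeff f i - coeff g i"
  unfolding coeff_def by (simp add: integrable_mult_xi left_diff_distrib)

lemma coeff_cmult: "coeff (\<lambda>x. c * f x) i = c * coeff f i"
  unfolding coeff_def by (simp add: mult.assoc)

lemma norm_coeff_le: "cmod (coeff f i) \<le> (\<integral>x. cmod (f x) \<partial>M)"
  unfolding coeff_def
  by (rule order_trans[OF integral_norm_bound]) (simp add: norm_mult)

lemma psum_add: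
  "integrable M f \<Longrightarrow> integrable M g \<Longrightarrow> psum j (\<lambda>x. f x + g x) x = psum j f x + psum j g x"
  by (simp add: psum_def coeff_add ring_distribs sum.distrib)

lemma psum_cmult: "psum j (\<lambda>x. c * f x) y = c * psum j f y"
  by (simp add: psum_def coeff_cmult sum_distrib_left mult.assoc)

lemma norm_psum_le_maxop: "ennreal (cmod (psum j h x)) \<le> maxop h x"
  unfolding maxop_def by (rule SUP_upper) simp

lemma maxop_add:
  assumes "integrable M f" "integrable M g"
  shows "maxop (\<lambda>x. f x + g x) y \<le> maxop f y + maxop g y"
  unfolding maxop_def[of "\<lambda>x. f x + g x"]
proof (rule SUP_least)
  fix j
  have "ennreal (cmod (psum j (\<lambda>x. f x + g x) y)) \<le> ennreal (cmod (psum j f y) + cmod (psum j g y))"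
    by (intro ennreal_leI) (simp add: psum_add[OF assms] norm_triangle_ineq)
  also have "\<dots> \<le> maxop f y + maxop g y"
    by (simp add: ennreal_plus add_mono norm_psum_le_maxop)
  finally show "ennreal (cmod (psum j (\<lambda>x. f x + g x) y)) \<le> maxop f y + maxop g y" .
qed

lemma maxop_cmult: "maxop (\<lambda>x. c * f x) y = ennreal (cmod c) * maxop f y"
  unfolding maxop_def by (simp add: psum_cmult norm_mult ennreal_mult SUP_mult_left_ennreal)

lemma maxop_gt_iff: "0 \<le> t \<Longrightarrow> maxop h x > ennreal t \<longleftrightarrow> (\<exists>j. cmod (psum j h x) > t)"
  by (simp add: maxop_def less_SUP_iff ennreal_less_iff)

lemma fourier_partial_sum_eq:
  "fourier_partial_sum M \<xi> j f x = psum j (\<lambda>x. of_real (real_of_ereal (f x))) x"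
  by (simp add: fourier_partial_sum_def psum_def fourier_coeff_def coeff_def)

lemma fourier_maximal_gt_iff:
  assumes "t > 0"
  shows "\<bar>fourier_maximal M \<xi> f x\<bar> > ereal t \<longleftrightarrow> maxop (\<lambda>x. of_real (real_of_ereal (f x))) x > ennreal t"
proof -
  define S where "S j = cmod (psum j (\<lambda>x. of_real (real_of_ereal (f x))) x)" for j
  have F: "fourier_maximal M \<xi> f x = (SUP j\<in>{1..}. ereal (S j))"
    by (simp add: fourier_maximal_def fourier_partial_sum_eq S_def)
  have "0 \<le> ereal (S 1)" by (simp add: S_def)
  also have "\<dots> \<le> fourier_maximal M \<xi> f x"
    unfolding F by (rule SUP_upper) simp
  finally have "\<bar>fourier_maximal M \<xi> f x\<bar> = fourier_maximal M \<xi> f x" by simp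
  then have "\<bar>fourier_maximal M \<xi> f x\<bar> > ereal t \<longleftrightarrow> (\<exists>j\<ge>1. S j > t)"
    unfolding F by (simp add: less_SUP_iff Bex_def)
  also have "\<dots> \<longleftrightarrow> (\<exists>j. S j > t)"
  proof
    \<comment> \<open>The given operator starts at j = 1; the extra index 0 cannot exceed t >
      0.\<close>
    assume "\<exists>j. S j > t"
    then obtain j where j: "S j > t" by blast
    have "S 0 = 0" by (simp add: S_def psum_def)
    then have "j \<noteq> 0" using j assms by (metis less_asym)
    then show "\<exists>j\<ge>1. S j > t" using j by (intro exI[of _ j]) simp
  qed blast
  also have "\<dots> \<longleftrightarrow> maxop (\<lambda>x. of_real (real_of_ereal (f x))) x > ennreal t"
    unfolding S_def using assms by (intro maxop_gt_iff[symmetric]) simp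
  finally show ?thesis .
qed

section \<open>Orthogonal projection and Bessel's inequality\<close>

lemma norm_psum_le: "cmod (psum n f x) \<le> (\<Sum>i<n. cmod (coeff f i))"
  unfolding psum_def by (rule order_trans[OF norm_sum]) (simp add: norm_mult)

lemma square_integrable_psum [simp]: "square_integrable M (psum n f)"
  by (rule square_integrable_bounded[OF _ norm_psum_le]) measurable

lemma integrable_psum [simp]: "integrable M (psum n f)"
  by (rule integrable_square_integrable) simp

lemma integral_mult_cnj_psum:
  assumes "integrable M g"
  shows "(\<integral>x. g x * cnj (psum n f x) \<partial>M) = (\<Sum>i<n. cnj (coeff f i) * coeff g i)"
proof -
  have "(\<integral>x. g x * cnj (psum n f x) \<partial>M) = (\<integral>x. (\<Sum>i<n. cnj (coeff f i) * (g x * cnj (\<xi> i x))) \<partial>M)"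
    by (simp add: psum_def sum_distrib_left mult_ac)
  also have "\<dots> = (\<Sum>i<n. cnj (coeff f i) * coeff g i)"
    using assms by (subst Bochner_Integration.integral_sum) (auto simp: coeff_def)
  finally show ?thesis .
qed

lemma integrable_xi [simp]: "integrable M (\<xi> i)"
  by (rule integrable_const_bound[where B=1]) auto

lemma coeff_psum: "coeff (psum n f) i = (if i < n then coeff f i else 0)"
proof -
  have "coeff (psum n f) i = (\<integral>x. (\<Sum>k<n. coeff f k * (\<xi> k x * cnj (\<xi> i x))) \<partial>M)"
    by (simp add: coeff_def psum_def sum_distrib_right mult.assoc)
  also have "\<dots> = (\<Sum>k<n. coeff f k * (if k = i then 1 else 0))"
    by (subst Bochner_Integration.integral_sum) (auto simp: xi_orthonormal intro!: integrable_mult_xi)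
  also have "\<dots> = (\<Sum>k<n. if k = i then coeff f k else 0)"
    by (intro sum.cong) auto
  finally show ?thesis by simp
qed

text \<open>The source of convergence: for a finite combination of the characters the expansion is
  eventually constant, so only a remainder is left to the maximal inequality.\<close>

lemma psum_psum: "j \<ge> n \<Longrightarrow> psum j (psum n f) = psum n f"
proof
  fix x assume "n \<le> j"
  then have "(\<Sum>i<n. coeff f i * \<xi> i x) = (\<Sum>i<j. coeff (psum n f) i * \<xi> i x)"
    by (intro sum.mono_neutral_cong_left) (auto simp: coeff_psum)
  then show "psum j (psum n f) x = psum n f x" by (simp add: psum_def)
qed

text \<open>Pythagoras for the projection onto the first n characters, kept as an equation: Bessel's
  inequality and the distances between partial sums are both read off from it.\<close>

lemma integral_norm_diff_psum:
  assumes "square_integrable M f"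
  shows "(\<integral>x. (cmod (f x - psum n f x))\<^sup>2 \<partial>M) = (\<integral>x. (cmod (f x))\<^sup>2 \<partial>M) - (\<Sum>i<n. (cmod (coeff f i))\<^sup>2)"
proof -
  have int: "integrable M f" by (rule integrable_square_integrable[OF assms])
  have [measurable]: "f \<in> borel_measurable M" using int by simp
  have int_mult: "integrable M (\<lambda>x. f x * cnj (psum n f x))"
  proof (rule Bochner_Integration.integrable_bound)
    show "integrable M (\<lambda>x. (\<Sum>i<n. cmod (coeff f i)) *\<^sub>R f x)" using int by simp
    show "AE x in M. norm (f x * cnj (psum n f x)) \<le> norm ((\<Sum>i<n. cmod (coeff f i)) *\<^sub>R f x)"
      by (intro AE_I2) (simp add: norm_mult abs_of_nonneg sum_nonneg mult.commute mult_left_mono norm_psum_le)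
  qed measurable
  have int_sq: "integrable M (\<lambda>x. (cmod (f x))\<^sup>2)" "integrable M (\<lambda>x. (cmod (psum n f x))\<^sup>2)"
    using assms square_integrable_psum by (auto simp only: square_integrable_def)
  have sq: "(\<integral>x. (cmod (psum n f x))\<^sup>2 \<partial>M) = (\<Sum>i<n. (cmod (coeff f i))\<^sup>2)"
  proof -
    have "complex_of_real (\<integral>x. (cmod (psum n f x))\<^sup>2 \<partial>M) = (\<integral>x. psum n f x * cnj (psum n f x) \<partial>M)"
      by (subst integral_complex_of_real[symmetric]) (simp only: complex_norm_square)
    also have "\<dots> = (\<Sum>i<n. cnj (coeff f i) * coeff f i)"
      by (subst integral_mult_cnj_psum) (auto simp: coeff_psum)
    also have "\<dots> = complex_of_real (\<Sum>i<n. (cmod (coeff f i))\<^sup>2)"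
      unfolding of_real_sum by (intro sum.cong refl) (simp only: complex_norm_square mult.commute)
    finally show ?thesis by (simp only: of_real_eq_iff)
  qed
  have cr: "Re (\<integral>x. f x * cnj (psum n f x) \<partial>M) = (\<Sum>i<n. (cmod (coeff f i))\<^sup>2)"
    unfolding integral_mult_cnj_psum[OF int] Re_sum
    by (intro sum.cong refl, simp only: cmod_power2) (simp add: power2_eq_square)
  have "(cmod (a - b))\<^sup>2 = (cmod a)\<^sup>2 - 2 * Re (a * cnj b) + (cmod b)\<^sup>2" for a b
    unfolding cmod_power2 by (simp add: power2_eq_square algebra_simps)
  then have "(\<integral>x. (cmod (f x - psum n f x))\<^sup>2 \<partial>M)
    = (\<integral>x. (cmod (f x))\<^sup>2 - 2 * Re (f x * cnj (psum n f x)) + (cmod (psum n f x))\<^sup>2 \<partial>M)" by simp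
  also have "\<dots> = (\<integral>x. (cmod (f x))\<^sup>2 \<partial>M) - 2 * Re (\<integral>x. f x * cnj (psum n f x) \<partial>M) + (\<integral>x. (cmod (psum n f x))\<^sup>2 \<partial>M)"
    using int_mult int_sq
    by (simp add: Bochner_Integration.integral_add Bochner_Integration.integral_diff integrable_Re integral_Re del: minus_complex.simps times_complex.simps)
  finally show ?thesis using sq cr by simp
qed

lemma bessel_inequality:
  assumes "square_integrable M f"
  shows "(\<Sum>i<n. (cmod (coeff f i))\<^sup>2) \<le> (\<integral>x. (cmod (f x))\<^sup>2 \<partial>M)"
proof -
  have "0 \<le> (\<integral>x. (cmod (f x - psum n f x))\<^sup>2 \<partial>M)" by simp
  then show ?thesis using integral_norm_diff_psum[OF assms, of n] by simp
qed

subsection \<open>Approximation by indicators\<close>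

text \<open>All coefficients of the indicator of an atom of mass c have modulus c, because
  characters have modulus 1; Bessel then gives n c ^ 2 \<le> c for every n.\<close>

lemma measure_singleton: "measure M {x} = 0"
proof (rule ccontr)
  let ?c = "measure M {x}"
  assume "?c \<noteq> 0"
  then have c: "?c > 0" by (simp add: zero_less_measure_iff)
  have [measurable]: "{x} \<in> sets M" by (simp add: sets_M)
  let ?f = "\<lambda>y. indicator {x} y :: complex"
  have sq: "square_integrable M ?f"
    by (rule square_integrable_bounded[where B=1]) (auto simp: indicator_def)
  have "coeff ?f i = ?c * cnj (\<xi> i x)" for i
  proof -
    have "coeff ?f i = (\<integral>y. indicator {x} y *\<^sub>R cnj (\<xi> i x) \<partial>M)"
      unfolding coeff_def by (intro Bochner_Integration.integral_cong) (auto simp: indicator_def)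
    also have "\<dots> = ?c * cnj (\<xi> i x)" by (simp add: scaleR_conv_of_real)
    finally show ?thesis .
  qed
  then have "(\<Sum>i<n. (cmod (coeff ?f i))\<^sup>2) = n * ?c\<^sup>2" for n by (simp add: norm_mult)
  moreover have "(\<integral>y. (cmod (?f y))\<^sup>2 \<partial>M) = (\<integral>y. indicator {x} y \<partial>M)"
    by (intro Bochner_Integration.integral_cong) (auto simp: indicator_def)
  ultimately have le: "real n * ?c\<^sup>2 \<le> ?c" for n
    using bessel_inequality[OF sq, of n] by simp
  obtain n where "1 / ?c < real n" using reals_Archimedean2 by blast
  then have "1 < real n * ?c" using c by (simp add: field_simps)
  then have "?c * 1 < ?c * (real n * ?c)" using c by (intro mult_strict_left_mono)
  then show False using le[of n] by (simp add: power2_eq_square mult_ac)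
qed

lemma small_neighbourhood:
  assumes "\<delta> > 0"
  obtains U where "open U" "x \<in> U" "measure M U < \<delta>"
proof -
  have "emeasure M {x} = (INF U\<in>{U. open U \<and> {x} \<subseteq> U}. emeasure M U)"
    by (rule outer_regular) simp
  moreover have "emeasure M {x} < ennreal \<delta>"
    using assms by (simp add: emeasure_eq_measure measure_singleton)
  ultimately obtain U where "open U" "x \<in> U" "emeasure M U < ennreal \<delta>"
    by (auto simp: INF_less_iff)
  then show ?thesis using assms that by (simp add: emeasure_eq_measure ennreal_less_iff)
qed

lemma open_sets_M [measurable]: "open U \<Longrightarrow> U \<in> sets M"
  by (simp add: sets_M)

lemma finite_cover:
  fixes U :: "'a \<Rightarrow> 'a set"
  assumes "\<And>x. open (U x)" "\<And>x. x \<in> U x"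
  obtains C where "finite C" "(\<Union>x\<in>C. U x) = UNIV"
proof -
  have "UNIV \<subseteq> (\<Union>x\<in>UNIV. U x)" using assms(2) by auto
  then obtain C where "finite C" "UNIV \<subseteq> (\<Union>x\<in>C. U x)"
    using compactE_image[OF compact_space, of UNIV U] assms(1) by auto
  then show ?thesis using that by auto
qed

text \<open>An approximate intermediate value property, from compactness: cover the space by
  finitely many open sets of measure below \<delta> and add them one at a time. The measure inside P
  grows in steps below \<delta>, so the last union still below c misses it by less than
  \<delta>.\<close>

lemma subset_of_measure:
  assumes [measurable]: "P \<in> sets M" and c: "0 \<le> c" "c \<le> measure M P" and "\<delta> > 0"
  obtains E where "E \<in> sets M" "E \<subseteq> P" "c - \<delta> \<le> measure M E" "measure M E \<le> c"
proof -
  have "\<exists>U. open U \<and> x \<in> U \<and> measure M U < \<delta>" for x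
    using small_neighbourhood[OF \<open>\<delta> > 0\<close>, of x] by blast
  then obtain U where U: "\<And>x. open (U x)" "\<And>x. x \<in> U x" "\<And>x. measure M (U x) < \<delta>" by metis
  obtain C where C: "finite C" "(\<Union>x\<in>C. U x) = UNIV" using finite_cover[of U] U by blast
  have "c \<le> measure M (P \<inter> (\<Union>x\<in>C. U x)) \<Longrightarrow>
      \<exists>E\<in>sets M. E \<subseteq> P \<and> c - \<delta> \<le> measure M E \<and> measure M E \<le> c"
    using C(1)
  proof (induction C rule: finite_induct)
    case empty
    then show ?case using c(1) \<open>\<delta> > 0\<close> by (intro bexI[of _ "{}"]) auto
  next
    case (insert x C)
    let ?E = "P \<inter> (\<Union>x\<in>C. U x)"
    have op: "open (\<Union>x\<in>C. U x)" using U(1) by auto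
    have [measurable]: "?E \<in> sets M" "U x \<in> sets M" using open_sets_M[OF op] open_sets_M U(1) by auto
    show ?case
    proof (cases "c \<le> measure M ?E")
      case False
      have "measure M (P \<inter> (\<Union>x\<in>insert x C. U x)) \<le> measure M (?E \<union> U x)"
        by (intro finite_measure_mono) auto
      also have "\<dots> \<le> measure M ?E + measure M (U x)"
        by (intro measure_Un_le) auto
      finally have "c - \<delta> \<le> measure M ?E" using insert.prems U(3)[of x] by simp
      then show ?thesis using False by (intro bexI[of _ ?E]) auto
    qed (use insert in blast)
  qed
  then show ?thesis using c(2) C(2) that by auto
qed

lemma integrable_unit_interval:
  fixes g :: "'a \<Rightarrow> real"
  assumes "g \<in> borel_measurable M" "\<And>x. 0 \<le> g x" "\<And>x. g x \<le> 1"
  shows "integrable M g"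
  using assms by (intro integrable_const_bound[where B=1]) auto

lemma integrable_indicator_sets: "A \<in> sets M \<Longrightarrow> integrable M (indicator A :: 'a \<Rightarrow> real)"
  by (rule integrable_unit_interval) auto

text \<open>Where the characters hardly vary, a coefficient sees little more than total mass, so E
  only has to match the mass of g on P. It does so from below, which keeps the measure of E under
  the integral of g without any error term. The point x is a mere reference and may lie outside
  P.\<close>

lemma approximate_on_piece:
  fixes g :: "'a \<Rightarrow> real"
  assumes [measurable]: "g \<in> borel_measurable M" "P \<in> sets M"
    and g: "\<And>x. 0 \<le> g x" "\<And>x. g x \<le> 1" and "\<delta> > 0"
    and osc: "\<And>i y. i < N \<Longrightarrow> y \<in> P \<Longrightarrow> cmod (\<xi> i y - \<xi> i x) \<le> \<eta>"
  obtains E where "E \<in> sets M" "E \<subseteq> P" "measure M E \<le> (\<integral>y. g y * indicator P y \<partial>M)"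
    "\<And>i. i < N \<Longrightarrow> cmod (\<integral>y. of_real (g y * indicator P y - indicator E y) * cnj (\<xi> i y) \<partial>M)
      \<le> \<eta> * measure M P + \<delta>"
proof -
  let ?c = "\<integral>y. g y * indicator P y \<partial>M"
  have gP: "integrable M (\<lambda>y. g y * indicator P y)"
    using g by (intro integrable_unit_interval) (auto simp: indicator_def)
  have c: "0 \<le> ?c" using g by (intro Bochner_Integration.integral_nonneg) auto
  have "?c \<le> (\<integral>y. indicator P y \<partial>M)"
    using g by (intro integral_mono gP integrable_indicator_sets) (auto simp: indicator_def)
  then have "?c \<le> measure M P" by simp
  then obtain E where E [measurable]: "E \<in> sets M" "E \<subseteq> P" and E2: "?c - \<delta> \<le> measure M E" "measure M E \<le> ?c"
    using subset_of_measure[OF _ c _ \<open>\<delta> > 0\<close>, of P] assms(2) by blast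
  let ?d = "\<lambda>y. g y * indicator P y - indicator E y"
  have d: "integrable M ?d" by (intro Bochner_Integration.integrable_diff gP integrable_indicator_sets E)
  have d': "integrable M (\<lambda>y. complex_of_real (?d y))" using d by (rule integrable_of_real)
  have "cmod (\<integral>y. of_real (?d y) * cnj (\<xi> i y) \<partial>M) \<le> \<eta> * measure M P + \<delta>" if i: "i < N" for i
  proof -
    have int1: "integrable M (\<lambda>y. of_real (?d y) * cnj (\<xi> i y - \<xi> i x))"
    proof -
      have "integrable M (\<lambda>y. of_real (?d y) * cnj (\<xi> i y) - of_real (?d y) * cnj (\<xi> i x))"
        using integrable_mult_xi[OF d', of i] d' by (intro Bochner_Integration.integrable_diff integrable_mult_left) auto
      then show ?thesis by (simp add: algebra_simps)
    qed
    \<comment> \<open>Split off the constant value at x: what varies is small by oscillation, what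
      is constant sees only the mass defect.\<close>
    have "(\<integral>y. of_real (?d y) * cnj (\<xi> i y) \<partial>M)
      = (\<integral>y. of_real (?d y) * cnj (\<xi> i y - \<xi> i x) + of_real (?d y) * cnj (\<xi> i x) \<partial>M)"
      by (simp add: algebra_simps)
    also have "\<dots> = (\<integral>y. of_real (?d y) * cnj (\<xi> i y - \<xi> i x) \<partial>M) + (\<integral>y. of_real (?d y) \<partial>M) * cnj (\<xi> i x)"
      using int1 d' by (subst Bochner_Integration.integral_add) auto
    also have "(\<integral>y. of_real (?d y) \<partial>M) = complex_of_real (?c - measure M E)"
      unfolding integral_complex_of_real using gP integrable_indicator_sets[OF E(1)] by (subst Bochner_Integration.integral_diff) auto
    finally have eq: "(\<integral>y. of_real (?d y) * cnj (\<xi> i y) \<partial>M)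
      = (\<integral>y. of_real (?d y) * cnj (\<xi> i y - \<xi> i x) \<partial>M) + complex_of_real (?c - measure M E) * cnj (\<xi> i x)" .
    have "cmod (\<integral>y. of_real (?d y) * cnj (\<xi> i y - \<xi> i x) \<partial>M) \<le> (\<integral>y. cmod (of_real (?d y) * cnj (\<xi> i y - \<xi> i x)) \<partial>M)"
      by (rule integral_norm_bound)
    also have "\<dots> \<le> (\<integral>y. \<eta> * indicator P y \<partial>M)"
    proof (rule integral_mono)
      show "integrable M (\<lambda>y. cmod (of_real (?d y) * cnj (\<xi> i y - \<xi> i x)))" using int1 by simp
      show "integrable M (\<lambda>y. \<eta> * indicator P y)"
        by (intro integrable_mult_right integrable_indicator_sets assms)
      fix y
      show "cmod (of_real (?d y) * cnj (\<xi> i y - \<xi> i x)) \<le> \<eta> * indicator P y"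
      proof (cases "y \<in> P")
        case True
        have "\<bar>?d y\<bar> \<le> 1" using g[of y] True by (auto simp: indicator_def)
        then have "\<bar>?d y\<bar> * cmod (\<xi> i y - \<xi> i x) \<le> 1 * \<eta>"
          using osc[OF i True] by (intro mult_mono) auto
        then show ?thesis using True by (simp only: norm_mult complex_mod_cnj norm_of_real) simp
      next
        case False
        then have "y \<notin> E" using E by auto
        then show ?thesis using False by simp
      qed
    qed
    also have "\<dots> = \<eta> * measure M P" by simp
    finally have "cmod (\<integral>y. of_real (?d y) * cnj (\<xi> i y - \<xi> i x) \<partial>M) \<le> \<eta> * measure M P" .
    moreover have "cmod (complex_of_real (?c - measure M E) * cnj (\<xi> i x)) \<le> \<delta>"
    proof -
      have "\<bar>?c - measure M E\<bar> \<le> \<delta>" using E2 by (intro abs_leI; linarith)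
      then show ?thesis by (simp only: norm_mult complex_mod_cnj norm_xi norm_of_real mult_1_right)
    qed
    ultimately show ?thesis unfolding eq by (intro norm_triangle_le add_mono)
  qed
  then show ?thesis using that E E2 by blast
qed

text \<open>Antonov's lemma: matching finitely many coefficients suffices, because each partial sum
  involves only finitely many of them.\<close>

lemma approximate_by_indicator:
  fixes g :: "'a \<Rightarrow> real"
  assumes [measurable]: "g \<in> borel_measurable M"
    and g: "\<And>x. 0 \<le> g x" "\<And>x. g x \<le> 1" and "\<epsilon> > 0"
  obtains E where "E \<in> sets M" "measure M E \<le> (\<integral>y. g y \<partial>M)"
    "\<And>i. i < N \<Longrightarrow> cmod (coeff (\<lambda>y. of_real (g y)) i - coeff (indicator E) i) \<le> \<epsilon>"
proof -
  \<comment> \<open>Half of \<epsilon> goes to oscillation, the other half to the mass defects,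
    shared among the cells by the choice of \<delta> below.\<close>
  define \<eta> where "\<eta> = \<epsilon> / 2"
  have "\<eta> > 0" using \<open>\<epsilon> > 0\<close> by (simp add: \<eta>_def)
  define U where "U x = (\<Inter>i<N. {y. cmod (\<xi> i y - \<xi> i x) < \<eta>})" for x
  have openU: "open (U x)" for x
    unfolding U_def by (intro open_INT open_Collect_less continuous_intros ballI continuous_xi) auto
  moreover have "x \<in> U x" for x using \<open>\<eta> > 0\<close> by (simp add: U_def)
  ultimately obtain C where C: "finite C" "(\<Union>x\<in>C. U x) = UNIV" using finite_cover[of U] by blast
  define \<delta> where "\<delta> = \<epsilon> / (2 * (card C + 1))"
  have "\<delta> > 0" using \<open>\<epsilon> > 0\<close> by (simp add: \<delta>_def)
  have "\<exists>E\<in>sets M. E \<subseteq> (\<Union>x\<in>C. U x) \<and> measure M E \<le> (\<integral>y. g y * indicator (\<Union>x\<in>C. U x) y \<partial>M) \<and>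
     (\<forall>i<N. cmod (\<integral>y. of_real (g y * indicator (\<Union>x\<in>C. U x) y - indicator E y) * cnj (\<xi> i y) \<partial>M)
       \<le> \<eta> * measure M (\<Union>x\<in>C. U x) + card C * \<delta>)"
    using C(1)
  proof (induction C rule: finite_induct)
    case empty
    then show ?case by (intro bexI[of _ "{}"]) auto
  next
    case (insert x C)
    define W where "W = (\<Union>x\<in>C. U x)"
    have "open W" unfolding W_def using openU by auto
    then have W [measurable]: "W \<in> sets M" by (rule open_sets_M)
    obtain E where E [measurable]: "E \<in> sets M" "E \<subseteq> W" "measure M E \<le> (\<integral>y. g y * indicator W y \<partial>M)"
      "\<And>i. i < N \<Longrightarrow> cmod (\<integral>y. of_real (g y * indicator W y - indicator E y) * cnj (\<xi> i y) \<partial>M)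
       \<le> \<eta> * measure M W + card C * \<delta>"
      using insert.IH unfolding W_def by blast
    \<comment> \<open>Removing what is covered already makes the cells disjoint; their oscillation
      errors then add up to \<eta> times the total measure 1, however many cells there are.\<close>
    define P where "P = U x - W"
    have P [measurable]: "P \<in> sets M" unfolding P_def using open_sets_M[OF openU] W by auto
    have osc: "cmod (\<xi> i y - \<xi> i x) \<le> \<eta>" if "i < N" "y \<in> P" for i y
      using that by (auto simp: P_def U_def intro: less_imp_le)
    obtain F where F [measurable]: "F \<in> sets M" "F \<subseteq> P" "measure M F \<le> (\<integral>y. g y * indicator P y \<partial>M)"
      "\<And>i. i < N \<Longrightarrow> cmod (\<integral>y. of_real (g y * indicator P y - indicator F y) * cnj (\<xi> i y) \<partial>M)
        \<le> \<eta> * measure M P + \<delta>"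
      using approximate_on_piece[OF assms(1) P g \<open>\<delta> > 0\<close> osc] by blast
    have disj: "W \<inter> P = {}" "E \<inter> F = {}" and un: "(\<Union>x\<in>insert x C. U x) = W \<union> P"
      using E(2) F(2) by (auto simp: P_def W_def)
    have int: "integrable M (\<lambda>y. g y * indicator A y)" if [measurable]: "A \<in> sets M" for A
      using g by (intro integrable_unit_interval) (auto simp: indicator_def)
    have int2: "integrable M (\<lambda>y. complex_of_real (g y * indicator A y - indicator B y) * cnj (\<xi> i y))"
      if [measurable]: "A \<in> sets M" "B \<in> sets M" for A B i
      by (intro integrable_mult_xi integrable_of_real Bochner_Integration.integrable_diff int integrable_indicator_sets that)
    show ?case
      unfolding un
    proof (intro bexI[of _ "E \<union> F"] conjI allI impI)
      have "measure M (E \<union> F) = measure M E + measure M F"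
        using disj by (intro finite_measure_Union) auto
      also have "\<dots> \<le> (\<integral>y. g y * indicator W y \<partial>M) + (\<integral>y. g y * indicator P y \<partial>M)"
        using E(3) F(3) by simp
      also have "\<dots> = (\<integral>y. g y * indicator W y + g y * indicator P y \<partial>M)"
        by (simp add: int)
      also have "\<dots> = (\<integral>y. g y * indicator (W \<union> P) y \<partial>M)"
        using disj by (intro Bochner_Integration.integral_cong) (auto simp: indicator_def)
      finally show "measure M (E \<union> F) \<le> (\<integral>y. g y * indicator (W \<union> P) y \<partial>M)" .
      fix i assume i: "i < N"
      have "(\<integral>y. of_real (g y * indicator (W \<union> P) y - indicator (E \<union> F) y) * cnj (\<xi> i y) \<partial>M)
        = (\<integral>y. of_real (g y * indicator W y - indicator E y) * cnj (\<xi> i y)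
            + of_real (g y * indicator P y - indicator F y) * cnj (\<xi> i y) \<partial>M)"
        using disj by (intro Bochner_Integration.integral_cong refl) (auto simp: indicator_def left_diff_distrib)
      also have "\<dots> = (\<integral>y. of_real (g y * indicator W y - indicator E y) * cnj (\<xi> i y) \<partial>M)
            + (\<integral>y. of_real (g y * indicator P y - indicator F y) * cnj (\<xi> i y) \<partial>M)"
        by (intro Bochner_Integration.integral_add int2) auto
      also have "cmod \<dots> \<le> (\<eta> * measure M W + card C * \<delta>) + (\<eta> * measure M P + \<delta>)"
        by (intro norm_triangle_le add_mono E F i)
      also have "\<dots> = \<eta> * measure M (W \<union> P) + card (insert x C) * \<delta>"
        using insert.hyps disj by (subst finite_measure_Union) (auto simp: algebra_simps)
      finally show "cmod (\<integral>y. of_real (g y * indicator (W \<union> P) y - indicator (E \<union> F) y) * cnj (\<xi> i y) \<partial>M)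
         \<le> \<eta> * measure M (W \<union> P) + card (insert x C) * \<delta>" .
    qed (use E(1,2) F(1,2) in auto)
  qed
  then obtain E where E [measurable]: "E \<in> sets M" and E2: "measure M E \<le> (\<integral>y. g y \<partial>M)"
    and E3: "\<And>i. i < N \<Longrightarrow> cmod (\<integral>y. of_real (g y - indicator E y) * cnj (\<xi> i y) \<partial>M) \<le> \<eta> + card C * \<delta>"
    unfolding C(2) by auto
  have "card C * \<delta> \<le> \<epsilon> / 2"
    using \<open>\<epsilon> > 0\<close> by (simp add: \<delta>_def field_simps)
  then have sm: "\<eta> + card C * \<delta> \<le> \<epsilon>" by (simp add: \<eta>_def)
  have "coeff (\<lambda>y. of_real (g y)) i - coeff (indicator E) i = (\<integral>y. of_real (g y - indicator E y) * cnj (\<xi> i y) \<partial>M)" for i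
  proof -
    have "integrable M (\<lambda>y. complex_of_real (g y))" "integrable M (indicator E :: 'a \<Rightarrow> complex)"
      using integrable_unit_interval[OF assms(1) g] by (auto intro: integrable_of_real integrable_const_bound[where B=1] simp: indicator_def)
    then have "coeff (\<lambda>y. of_real (g y)) i - coeff (indicator E) i
      = (\<integral>y. of_real (g y) * cnj (\<xi> i y) - indicator E y * cnj (\<xi> i y) \<partial>M)"
      unfolding coeff_def by (intro Bochner_Integration.integral_diff[symmetric] integrable_mult_xi)
    also have "\<dots> = (\<integral>y. of_real (g y - indicator E y) * cnj (\<xi> i y) \<partial>M)"
      by (intro Bochner_Integration.integral_cong refl) (auto simp: indicator_def algebra_simps)
    finally show ?thesis .
  qed
  then show ?thesis using that[OF E E2] E3 sm by fastforce
qed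

text \<open>The partial sums up to n depend on n coefficients only, so an indicator matching these
  can replace h. The set changes with n, but the bound sees only its measure, at most the integral
  of h, and continuity from below removes n. The 2 in t / (2 A) leaves half of the threshold for the
  approximation error.\<close>

lemma weak_type_bounded:
  fixes g :: "'a \<Rightarrow> real"
  assumes rw: "restricted_weak_type M (fourier_maximal M \<xi>) p K" and "K > 0" "p > 0"
    and [measurable]: "g \<in> borel_measurable M"
    and g: "\<And>x. 0 \<le> g x" "\<And>x. g x \<le> A" and "A > 0" "t > 0"
  shows "emeasure M {x. maxop (\<lambda>x. of_real (g x)) x > ennreal t}
    \<le> ennreal (K * (t / (2 * A)) powr (- p) / A) * (\<integral>\<^sup>+x. ennreal (g x) \<partial>M)"
proof -
  define h where "h x = g x / A" for x
  have [measurable]: "h \<in> borel_measurable M" unfolding h_def by measurable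
  have h: "\<And>x. 0 \<le> h x" "\<And>x. h x \<le> 1" using g \<open>A > 0\<close> by (auto simp: h_def)
  have int_h: "integrable M h" by (rule integrable_unit_interval) (use h in auto)
  define s where "s = t / (2 * A)"
  have "s > 0" using assms by (simp add: s_def)
  define D where "D n = {x. \<exists>j\<le>n. cmod (psum j (\<lambda>x. of_real (h x)) x) > 2 * s}" for n
  have D_sets: "D n \<in> sets M" for n
  proof -
    have "{x\<in>space M. \<exists>j\<le>n. cmod (psum j (\<lambda>x. of_real (h x)) x) > 2 * s} \<in> sets M" by measurable
    then show ?thesis by (simp add: D_def)
  qed
  have bound: "emeasure M (D n) \<le> ennreal (K * s powr (- p)) * ennreal (\<integral>x. h x \<partial>M)" for n
  proof -
    \<comment> \<open>At most n coefficient errors, against characters of modulus 1, then add up to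
      at most s.\<close>
    define \<epsilon> where "\<epsilon> = s / (n + 1)"
    have "\<epsilon> > 0" using \<open>s > 0\<close> by (simp add: \<epsilon>_def)
    obtain E where E [measurable]: "E \<in> sets M" and E2: "measure M E \<le> (\<integral>y. h y \<partial>M)"
      and E3: "\<And>i. i < n \<Longrightarrow> cmod (coeff (\<lambda>y. of_real (h y)) i - coeff (indicator E) i) \<le> \<epsilon>"
      using approximate_by_indicator[of h \<epsilon> n] h \<open>\<epsilon> > 0\<close> by auto
    have ind: "(\<lambda>x. complex_of_real (real_of_ereal (indicator E x))) = indicator E"
      by (auto simp: indicator_def)
    have close: "cmod (psum j (\<lambda>x. of_real (h x)) x - psum j (indicator E) x) \<le> s" if "j \<le> n" for j x
    proof -
      have "psum j (\<lambda>x. of_real (h x)) x - psum j (indicator E) x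
        = (\<Sum>i<j. (coeff (\<lambda>x. of_real (h x)) i - coeff (indicator E) i) * \<xi> i x)"
        by (simp add: psum_def sum_subtractf[symmetric] left_diff_distrib)
      also have "cmod \<dots> \<le> (\<Sum>i<j. \<epsilon>)"
        using that by (intro order_trans[OF norm_sum] sum_mono) (auto simp: norm_mult intro: E3)
      also have "\<dots> \<le> (n + 1) * \<epsilon>" using that \<open>\<epsilon> > 0\<close> by simp
      also have "\<dots> = s" by (simp add: \<epsilon>_def)
      finally show ?thesis .
    qed
    have "D n \<subseteq> {x \<in> space M. \<bar>fourier_maximal M \<xi> (indicator E) x\<bar> > ereal s}"
    proof
      fix x assume "x \<in> D n"
      then obtain j where j: "j \<le> n" "cmod (psum j (\<lambda>x. of_real (h x)) x) > 2 * s"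
        by (auto simp: D_def)
      then have "cmod (psum j (indicator E) x) > s"
        using close[OF j(1), of x] norm_triangle_sub[of "psum j (\<lambda>x. of_real (h x)) x" "psum j (indicator E) x"]
        by linarith
      then have "maxop (indicator E) x > ennreal s"
        using \<open>s > 0\<close> by (subst maxop_gt_iff) auto
      then show "x \<in> {x \<in> space M. \<bar>fourier_maximal M \<xi> (indicator E) x\<bar> > ereal s}"
        using \<open>s > 0\<close> by (simp add: fourier_maximal_gt_iff ind)
    qed
    moreover have "{x \<in> space M. \<bar>fourier_maximal M \<xi> (indicator E) x\<bar> > ereal s} \<in> sets M"
    proof -
      have "{x \<in> space M. maxop (indicator E) x > ennreal s} \<in> sets M" by measurable
      then show ?thesis using \<open>s > 0\<close> by (simp add: fourier_maximal_gt_iff ind)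
    qed
    ultimately have "emeasure M (D n) \<le> emeasure M {x \<in> space M. \<bar>fourier_maximal M \<xi> (indicator E) x\<bar> > ereal s}"
      by (rule emeasure_mono)
    also have "\<dots> \<le> ennreal (K * s powr (- p)) * emeasure M E"
      using rw[unfolded restricted_weak_type_def, rule_format, OF E _ \<open>s > 0\<close>] emeasure_finite[of E]
      by (simp add: less_top[symmetric])
    also have "\<dots> \<le> ennreal (K * s powr (- p)) * ennreal (\<integral>x. h x \<partial>M)"
      using E2 by (intro mult_left_mono) (auto simp: emeasure_eq_measure intro: ennreal_leI)
    finally show ?thesis .
  qed
  have "{x. maxop (\<lambda>x. of_real (g x)) x > ennreal t} = (\<Union>n. D n)"
  proof -
    have gh: "(\<lambda>x. complex_of_real (g x)) = (\<lambda>x. complex_of_real A * complex_of_real (h x))"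
      using \<open>A > 0\<close> by (auto simp: h_def)
    have "cmod (psum j (\<lambda>x. of_real (g x)) x) > t \<longleftrightarrow> cmod (psum j (\<lambda>x. of_real (h x)) x) > 2 * s" for j x
      unfolding gh psum_cmult norm_mult s_def using \<open>A > 0\<close> by (simp add: field_simps)
    then show ?thesis using \<open>t > 0\<close> by (auto simp: maxop_gt_iff D_def)
  qed
  also have "emeasure M (\<Union>n. D n) = (SUP n. emeasure M (D n))"
  proof (rule SUP_emeasure_incseq[symmetric])
    show "range D \<subseteq> sets M" using D_sets by auto
    show "incseq D" by (auto simp: incseq_def D_def intro: order_trans)
  qed
  also have "\<dots> \<le> ennreal (K * s powr (- p)) * ennreal (\<integral>x. h x \<partial>M)"
    by (intro SUP_least bound)
  also have "ennreal (\<integral>x. h x \<partial>M) = (\<integral>\<^sup>+x. ennreal (h x) \<partial>M)"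
    using int_h h by (intro nn_integral_eq_integral[symmetric]) auto
  also have "\<dots> = (\<integral>\<^sup>+x. ennreal (1 / A) * ennreal (g x) \<partial>M)"
    using \<open>A > 0\<close> g by (simp add: h_def ennreal_mult[symmetric])
  also have "\<dots> = ennreal (1 / A) * (\<integral>\<^sup>+x. ennreal (g x) \<partial>M)"
    by (rule nn_integral_cmult) measurable
  also have "ennreal (K * s powr (- p)) * (ennreal (1 / A) * (\<integral>\<^sup>+x. ennreal (g x) \<partial>M))
    = ennreal (K * s powr (- p) / A) * (\<integral>\<^sup>+x. ennreal (g x) \<partial>M)"
    using \<open>K > 0\<close> \<open>A > 0\<close> by (simp add: mult.assoc[symmetric] ennreal_mult[symmetric])
  finally show ?thesis unfolding s_def .
qed

subsection \<open>The maximal inequality\<close>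

text \<open>Exponent and constant K vary with k; the point is that D depends on none of l, j, k and
  f. The product form is the one required by \<open>weak_type_suminf\<close>.\<close>

lemma weak_type_level:
  assumes H: "fourier_maximal M \<xi> \<in> H_class m M" and "m > 0"
  obtains D where "D > 0"
    "\<And>l j k f. 0 < l \<Longrightarrow> l \<le> 1 \<Longrightarrow> j \<le> depth k \<Longrightarrow> f \<in> borel_measurable M \<Longrightarrow>
      (\<And>x. 0 \<le> f x) \<Longrightarrow> (\<And>x. f x \<le> 2 ^ (2 ^ k)) \<Longrightarrow>
      emeasure M {x. maxop (\<lambda>x. of_real (f x)) x > ennreal (l / 2 ^ j)}
      \<le> ennreal (2 ^ j / l) * (ennreal (D / l * 2 powr (m * real k)) * (\<integral>\<^sup>+x. ennreal (f x) \<partial>M))"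
proof -
  obtain r C where rC: "r > 1" "C > 0" and rw: "\<And>p. 1 < p \<Longrightarrow> p < r \<Longrightarrow>
      \<exists>K>0. restricted_weak_type M (fourier_maximal M \<xi>) p K \<and> K \<le> (C / (p - 1)) powr (m * p)"
    using H unfolding H_class_def by blast
  \<comment> \<open>The half keeps p \<le> 1 + \<delta> strictly below r; the cap 1 keeps p \<le>
    2.\<close>
  define \<delta> where "\<delta> = min 1 ((r - 1) / 2)"
  have \<delta>: "0 < \<delta>" "\<delta> \<le> 1" "\<delta> < r - 1" using rC by (auto simp: \<delta>_def min_less_iff_disj)
  define D where "D = max 1 (C / \<delta>) powr (2 * m) * 2 powr m * 128"
  show ?thesis
  proof (rule that)
    have "max 1 (C / \<delta>) > 0" by simp
    then show "D > 0" unfolding D_def by (intro mult_pos_pos) auto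
    fix l :: real and j k and f :: "'a \<Rightarrow> real"
    assume l: "0 < l" "l \<le> 1" and j: "j \<le> depth k" and f: "f \<in> borel_measurable M" "\<And>x. 0 \<le> f x" "\<And>x. f x \<le> 2 ^ (2 ^ k)"
    define p where "p = 1 + \<delta> / 2 ^ k"
    have "\<delta> / 2 ^ k \<le> \<delta> / 1" using \<delta> by (intro divide_left_mono) auto
    then have "1 < p" "p < r" using \<delta> by (auto simp: p_def)
    then obtain K where K: "K > 0" "restricted_weak_type M (fourier_maximal M \<xi>) p K" "K \<le> (C / (p - 1)) powr (m * p)"
      using rw by blast
    have "emeasure M {x. maxop (\<lambda>x. of_real (f x)) x > ennreal (l / 2 ^ j)}
      \<le> ennreal (K * (l / 2 ^ j / (2 * 2 ^ (2 ^ k))) powr (- p) / 2 ^ (2 ^ k)) * (\<integral>\<^sup>+x. ennreal (f x) \<partial>M)"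
      using \<open>1 < p\<close> l by (intro weak_type_bounded K f) auto
    also have "\<dots> \<le> ennreal ((2 ^ j / l) * (D / l * 2 powr (m * real k))) * (\<integral>\<^sup>+x. ennreal (f x) \<partial>M)"
      unfolding D_def
      by (intro mult_right_mono ennreal_leI level_constant_bound[OF \<open>m > 0\<close> \<open>C > 0\<close> \<delta>(1,2) l j p_def K(3)]) simp
    also have "\<dots> = ennreal (2 ^ j / l) * (ennreal (D / l * 2 powr (m * real k)) * (\<integral>\<^sup>+x. ennreal (f x) \<partial>M))"
      using l \<open>D > 0\<close> by (subst ennreal_mult) (auto simp: mult.assoc)
    finally show "emeasure M {x. maxop (\<lambda>x. of_real (f x)) x > ennreal (l / 2 ^ j)}
      \<le> ennreal (2 ^ j / l) * (ennreal (D / l * 2 powr (m * real k)) * (\<integral>\<^sup>+x. ennreal (f x) \<partial>M))" .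
  qed
qed

text \<open>Finite subadditivity alone does not give the countable one. It holds because a partial
  sum involves finitely many coefficients, and each coefficient passes to the limit by dominated
  convergence.\<close>

lemma maxop_le_suminf:
  fixes h :: "nat \<Rightarrow> 'a \<Rightarrow> complex"
  assumes f: "integrable M f" and h: "\<And>k. integrable M (h k)"
    and dom: "\<And>n x. cmod (\<Sum>k<n. h k x) \<le> cmod (f x)"
    and sums: "\<And>x. (\<lambda>k. h k x) sums f x"
  shows "maxop f x \<le> (\<Sum>k. maxop (h k) x)"
  unfolding maxop_def[of f]
proof (rule SUP_least)
  fix j
  have [measurable]: "f \<in> borel_measurable M" "\<And>k. h k \<in> borel_measurable M" using f h by auto
  have coeff_sums: "(\<lambda>k. coeff (h k) i) sums coeff f i" for i
  proof -
    have "(\<lambda>n. \<integral>x. (\<Sum>k<n. h k x) * cnj (\<xi> i x) \<partial>M) \<longlonglongrightarrow> (\<integral>x. f x * cnj (\<xi> i x) \<partial>M)"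
    proof (rule integral_dominated_convergence[where w="\<lambda>x. cmod (f x)"])
      show "AE x in M. (\<lambda>n. (\<Sum>k<n. h k x) * cnj (\<xi> i x)) \<longlonglongrightarrow> f x * cnj (\<xi> i x)"
        using sums by (intro AE_I2 tendsto_mult tendsto_const) (simp add: sums_def)
    qed (use f dom in \<open>auto simp: norm_mult\<close>)
    moreover have "(\<integral>x. (\<Sum>k<n. h k x) * cnj (\<xi> i x) \<partial>M) = (\<Sum>k<n. coeff (h k) i)" for n
      unfolding coeff_def sum_distrib_right
      by (intro Bochner_Integration.integral_sum integrable_mult_xi h)
    ultimately show ?thesis by (simp add: sums_def coeff_def)
  qed
  have "(\<lambda>k. psum j (h k) x) sums psum j f x"
    unfolding psum_def by (intro sums_sum sums_mult2 coeff_sums)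
  then have lim: "(\<lambda>n. ennreal (cmod (\<Sum>k<n. psum j (h k) x))) \<longlonglongrightarrow> ennreal (cmod (psum j f x))"
    by (intro tendsto_ennrealI tendsto_norm) (simp add: sums_def)
  show "ennreal (cmod (psum j f x)) \<le> (\<Sum>k. maxop (h k) x)"
  proof (rule LIMSEQ_le_const2[OF lim], intro exI allI impI)
    fix n :: nat
    have "ennreal (cmod (\<Sum>k<n. psum j (h k) x)) \<le> ennreal (\<Sum>k<n. cmod (psum j (h k) x))"
      by (intro ennreal_leI norm_sum)
    also have "\<dots> = (\<Sum>k<n. ennreal (cmod (psum j (h k) x)))" by simp
    also have "\<dots> \<le> (\<Sum>k<n. maxop (h k) x)" by (intro sum_mono norm_psum_le_maxop)
    also have "\<dots> \<le> (\<Sum>k. maxop (h k) x)" by (intro sum_le_suminf) auto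
    finally show "ennreal (cmod (\<Sum>k<n. psum j (h k) x)) \<le> (\<Sum>k. maxop (h k) x)" .
  qed
qed

lemma weighted_bound_nonneg:
  assumes H: "fourier_maximal M \<xi> \<in> H_class m M" and "m > 0" and l: "0 < l" "l \<le> 1"
  obtains D where "D > 0"
    "\<And>f :: 'a \<Rightarrow> real. integrable M f \<Longrightarrow> (\<And>x. 0 \<le> f x) \<Longrightarrow>
      emeasure M {x. maxop (\<lambda>x. of_real (f x)) x > ennreal (2 * l)}
      \<le> ennreal D * (\<integral>\<^sup>+x. ennreal (f x * weight m (f x)) \<partial>M)"
proof -
  obtain D where D: "D > 0"
    "\<And>l j k f. 0 < l \<Longrightarrow> l \<le> 1 \<Longrightarrow> j \<le> depth k \<Longrightarrow> f \<in> borel_measurable M \<Longrightarrow>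
      (\<And>x. 0 \<le> f x) \<Longrightarrow> (\<And>x. f x \<le> 2 ^ (2 ^ k)) \<Longrightarrow>
      emeasure M {x. maxop (\<lambda>x. of_real (f x)) x > ennreal (l / 2 ^ j)}
      \<le> ennreal (2 ^ j / l) * (ennreal (D / l * 2 powr (m * real k)) * (\<integral>\<^sup>+x. ennreal (f x) \<partial>M))"
    using weak_type_level[OF H \<open>m > 0\<close>] by blast
  show ?thesis
  proof (rule that)
    \<comment> \<open>One factor 1 / l comes from \<open>weak_type_suminf\<close>, the other from
      the weak type constant of each level.\<close>
    show "1 / l * (D / l) > 0" using D(1) l by simp
    fix f :: "'a \<Rightarrow> real" assume f: "integrable M f" "\<And>x. 0 \<le> f x"
    then have [measurable]: "f \<in> borel_measurable M" by auto
    \<comment> \<open>The pieces have disjoint supports, so every finite sum of them is 0 or f x and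
      is dominated by f.\<close>
    define F where "F k x = (if level (f x) = k then f x else 0)" for k x
    have F_meas [measurable]: "F k \<in> borel_measurable M" for k unfolding F_def by measurable
    have F: "0 \<le> F k x" "F k x \<le> f x" "F k x \<le> 2 ^ (2 ^ k)" for k x
      using f(2)[of x] le_level[of "f x"] by (auto simp: F_def)
    have "emeasure M {x. maxop (\<lambda>x. of_real (f x)) x > ennreal (2 * l)}
      \<le> emeasure M {x \<in> space M. (\<Sum>k. maxop (\<lambda>x. of_real (F k x)) x) > ennreal (2 * l)}"
    proof (rule emeasure_mono)
      have "maxop (\<lambda>x. of_real (f x)) x \<le> (\<Sum>k. maxop (\<lambda>x. of_real (F k x)) x)" for x
      proof (rule maxop_le_suminf)
        show "integrable M (\<lambda>x. complex_of_real (f x))" using f by simp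
        show "integrable M (\<lambda>x. complex_of_real (F k x))" for k
          by (rule Bochner_Integration.integrable_bound[OF f(1)]) (use F f in auto)
        fix x
        have "(\<Sum>k<n. F k x) = (if level (f x) < n then f x else 0)" for n
          by (simp add: F_def)
        then show "cmod (\<Sum>k<n. of_real (F k x)) \<le> cmod (of_real (f x))" for n
          by (simp flip: of_real_sum)
        have "(\<lambda>k. if k = level (f x) then complex_of_real (f x) else 0) sums complex_of_real (f x)"
          by (rule sums_single)
        moreover have "(\<lambda>k. if k = level (f x) then complex_of_real (f x) else 0) = (\<lambda>k. of_real (F k x))"
          by (auto simp: F_def)
        ultimately show "(\<lambda>k. complex_of_real (F k x)) sums complex_of_real (f x)" by simp
      qed
      then show "{x. maxop (\<lambda>x. of_real (f x)) x > ennreal (2 * l)}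
        \<subseteq> {x \<in> space M. (\<Sum>k. maxop (\<lambda>x. of_real (F k x)) x) > ennreal (2 * l)}"
        by (auto intro: less_le_trans)
    qed measurable
    also have "\<dots> \<le> ennreal (1 / l) * (\<Sum>k. ennreal (1 + 2 * real (depth k)) *
        (ennreal (D / l * 2 powr (m * real k)) * (\<integral>\<^sup>+x. ennreal (F k x) \<partial>M)))"
    proof (rule weak_type_suminf)
      fix j k assume "j \<le> depth k"
      then show "emeasure M {x \<in> space M. ennreal (l / 2 ^ j) < maxop (\<lambda>x. of_real (F k x)) x}
        \<le> ennreal (2 ^ j / l) * (ennreal (D / l * 2 powr (m * real k)) * (\<integral>\<^sup>+x. ennreal (F k x) \<partial>M))"
        using D(2)[OF l, of j k "F k"] F by simp
    qed (use l suminf_depth in auto)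
    also have "(\<Sum>k. ennreal (1 + 2 * real (depth k)) *
        (ennreal (D / l * 2 powr (m * real k)) * (\<integral>\<^sup>+x. ennreal (F k x) \<partial>M)))
      = ennreal (D / l) * (\<Sum>k. \<integral>\<^sup>+x. ennreal (F k x * weight m (f x)) \<partial>M)"
    proof (subst ennreal_suminf_cmult[symmetric], rule suminf_cong)
      fix k
      \<comment> \<open>On the support of \<open>F k\<close> the weight of f x is the constant c:
        the summation factor and the growth in k fuse into \<open>weight m (f x)\<close>.\<close>
      define c where "c = (1 + 2 * real (depth k)) * 2 powr (m * real k)"
      have "F k x * weight m (f x) = c * F k x" for x
        by (simp add: F_def weight_def c_def)
      moreover have "c \<ge> 0" by (simp add: c_def)
      ultimately have "(\<integral>\<^sup>+x. ennreal (F k x * weight m (f x)) \<partial>M) = (\<integral>\<^sup>+x. ennreal c * ennreal (F k x) \<partial>M)"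
        by (simp only: ennreal_mult')
      also have "\<dots> = ennreal c * (\<integral>\<^sup>+x. ennreal (F k x) \<partial>M)"
        by (rule nn_integral_cmult) measurable
      finally have *: "(\<integral>\<^sup>+x. ennreal (F k x * weight m (f x)) \<partial>M)
        = ennreal c * (\<integral>\<^sup>+x. ennreal (F k x) \<partial>M)" .
      have "(1 + 2 * real (depth k)) * (D / l * 2 powr (m * real k)) = D / l * c"
        by (simp add: c_def)
      moreover have nn: "0 \<le> 1 + 2 * real (depth k)" "0 \<le> D / l" using D(1) l by auto
      ultimately show "ennreal (1 + 2 * real (depth k)) * (ennreal (D / l * 2 powr (m * real k)) * (\<integral>\<^sup>+x. ennreal (F k x) \<partial>M))
        = ennreal (D / l) * (\<integral>\<^sup>+x. ennreal (F k x * weight m (f x)) \<partial>M)"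
        unfolding * mult.assoc[symmetric] ennreal_mult'[OF nn(1), symmetric] ennreal_mult'[OF nn(2), symmetric]
        by (simp only: mult.assoc)
    qed
    also have "(\<Sum>k. \<integral>\<^sup>+x. ennreal (F k x * weight m (f x)) \<partial>M) = (\<integral>\<^sup>+x. (\<Sum>k. ennreal (F k x * weight m (f x))) \<partial>M)"
      by (intro nn_integral_suminf[symmetric]) measurable
    also have "\<dots> = (\<integral>\<^sup>+x. ennreal (f x * weight m (f x)) \<partial>M)"
    proof (intro nn_integral_cong)
      fix x
      have "(\<Sum>k. ennreal (F k x * weight m (f x))) = (\<Sum>k\<in>{level (f x)}. ennreal (F k x * weight m (f x)))"
        by (rule suminf_finite) (auto simp: F_def)
      then show "(\<Sum>k. ennreal (F k x * weight m (f x))) = ennreal (f x * weight m (f x))"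
        by (simp add: F_def)
    qed
    also have "ennreal (1 / l) * (ennreal (D / l) * (\<integral>\<^sup>+x. ennreal (f x * weight m (f x)) \<partial>M))
      = ennreal (1 / l * (D / l)) * (\<integral>\<^sup>+x. ennreal (f x * weight m (f x)) \<partial>M)"
      using D(1) l by (subst ennreal_mult) (auto simp: mult.assoc)
    finally show "emeasure M {x. maxop (\<lambda>x. of_real (f x)) x > ennreal (2 * l)}
      \<le> ennreal (1 / l * (D / l)) * (\<integral>\<^sup>+x. ennreal (f x * weight m (f x)) \<partial>M)" .
  qed
qed

text \<open>The second alternative is there because a small maximal function bounds the error of the
  expansion only if g itself is small too; it costs a Markov bound, as the weight is at least 1.
  Monotonicity of the weight lets the real and imaginary, positive and negative parts share the
  integral of g.\<close>

lemma weighted_bound: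
  assumes H: "fourier_maximal M \<xi> \<in> H_class m M" and "m > 0" and "0 < s" "s \<le> 1"
  obtains D where "D > 0"
    "\<And>g :: 'a \<Rightarrow> complex. integrable M g \<Longrightarrow>
      emeasure M {x. maxop g x > ennreal s \<or> cmod (g x) > s}
      \<le> ennreal D * (\<integral>\<^sup>+x. ennreal (cmod (g x) * weight m (cmod (g x))) \<partial>M)"
proof -
  \<comment> \<open>Four parts with threshold 2 l each make up s.\<close>
  define l where "l = s / 8"
  have l: "0 < l" "l \<le> 1" and s: "s = 4 * (2 * l)" using assms by (auto simp: l_def)
  obtain D where D: "D > 0" "\<And>f :: 'a \<Rightarrow> real. integrable M f \<Longrightarrow> (\<And>x. 0 \<le> f x) \<Longrightarrow>
      emeasure M {x. maxop (\<lambda>x. of_real (f x)) x > ennreal (2 * l)}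
      \<le> ennreal D * (\<integral>\<^sup>+x. ennreal (f x * weight m (f x)) \<partial>M)"
    using weighted_bound_nonneg[OF H \<open>m > 0\<close> l] by blast
  show ?thesis
  proof (rule that)
    show "4 * D + 1 / s > 0" using D(1) \<open>0 < s\<close> by (simp add: add_pos_pos)
    fix g :: "'a \<Rightarrow> complex" assume g: "integrable M g"
    then have [measurable]: "g \<in> borel_measurable M" by simp
    let ?Q = "\<integral>\<^sup>+x. ennreal (cmod (g x) * weight m (cmod (g x))) \<partial>M"
    let ?big = "\<lambda>h. {x. maxop (\<lambda>x. complex_of_real (h x)) x > ennreal (2 * l)}"
    have big_sets: "?big h \<in> sets M" if "h \<in> borel_measurable M" for h
    proof -
      have "{x \<in> space M. maxop (\<lambda>x. complex_of_real (h x)) x > ennreal (2 * l)} \<in> sets M" by measurable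
      then show ?thesis by simp
    qed
    have part: "integrable M h" "emeasure M (?big h) \<le> ennreal D * ?Q"
      if [measurable]: "h \<in> borel_measurable M" and h: "\<And>x. 0 \<le> h x" "\<And>x. h x \<le> cmod (g x)" for h
    proof -
      show *: "integrable M h"
        by (rule Bochner_Integration.integrable_bound[OF g]) (use h in auto)
      have "h x * weight m (h x) \<le> cmod (g x) * weight m (cmod (g x))" for x
        using h[of x] \<open>m > 0\<close> weight_mono[of m "h x" "cmod (g x)"] weight_ge_1[of m "h x"]
        by (intro mult_mono) auto
      then have "(\<integral>\<^sup>+x. ennreal (h x * weight m (h x)) \<partial>M) \<le> ?Q"
        by (intro nn_integral_mono ennreal_leI)
      then show "emeasure M (?big h) \<le> ennreal D * ?Q"
        by (intro order_trans[OF D(2)[OF * h(1)]] mult_left_mono) auto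
    qed
    define h1 where "h1 x = max 0 (Re (g x))" for x
    define h2 where "h2 x = max 0 (- Re (g x))" for x
    define h3 where "h3 x = max 0 (Im (g x))" for x
    define h4 where "h4 x = max 0 (- Im (g x))" for x
    have m1: "h1 \<in> borel_measurable M" "h2 \<in> borel_measurable M" "h3 \<in> borel_measurable M" "h4 \<in> borel_measurable M"
      unfolding h1_def h2_def h3_def h4_def by measurable
    have pos: "\<And>x. 0 \<le> h1 x" "\<And>x. 0 \<le> h2 x" "\<And>x. 0 \<le> h3 x" "\<And>x. 0 \<le> h4 x"
      by (auto simp: h1_def h2_def h3_def h4_def)
    have "h1 x \<le> cmod (g x) \<and> h2 x \<le> cmod (g x) \<and> h3 x \<le> cmod (g x) \<and> h4 x \<le> cmod (g x)" for x
      using abs_Re_le_cmod[of "g x"] abs_Im_le_cmod[of "g x"] by (auto simp: h1_def h2_def h3_def h4_def)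
    then have le: "\<And>x. h1 x \<le> cmod (g x)" "\<And>x. h2 x \<le> cmod (g x)" "\<And>x. h3 x \<le> cmod (g x)" "\<And>x. h4 x \<le> cmod (g x)"
      by auto
    note p1 = part[OF m1(1) pos(1) le(1)] and p2 = part[OF m1(2) pos(2) le(2)]
      and p3 = part[OF m1(3) pos(3) le(3)] and p4 = part[OF m1(4) pos(4) le(4)]
    have maxop_le: "maxop g x \<le> (maxop (\<lambda>x. of_real (h1 x)) x + maxop (\<lambda>x. of_real (h2 x)) x)
        + (maxop (\<lambda>x. of_real (h3 x)) x + maxop (\<lambda>x. of_real (h4 x)) x)" for x
    proof -
      have "g = (\<lambda>x. (of_real (h1 x) + (-1) * of_real (h2 x)) + (\<i> * of_real (h3 x) + (- \<i>) * of_real (h4 x)))"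
        by (auto simp: fun_eq_iff complex_eq_iff h1_def h2_def h3_def h4_def max_def)
      then have "maxop g x = maxop (\<lambda>x. (of_real (h1 x) + (-1) * of_real (h2 x)) + (\<i> * of_real (h3 x) + (- \<i>) * of_real (h4 x))) x"
        by (rule arg_cong[where f="\<lambda>g. maxop g x"])
      also have "\<dots> \<le> (maxop (\<lambda>x. of_real (h1 x)) x + maxop (\<lambda>x. (-1) * of_real (h2 x)) x)
        + (maxop (\<lambda>x. \<i> * of_real (h3 x)) x + maxop (\<lambda>x. (- \<i>) * of_real (h4 x)) x)"
        by (intro order_trans[OF maxop_add] add_mono maxop_add Bochner_Integration.integrable_add
            integrable_mult_right integrable_of_real p1(1) p2(1) p3(1) p4(1))
      also have "\<dots> = (maxop (\<lambda>x. of_real (h1 x)) x + maxop (\<lambda>x. of_real (h2 x)) x)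
        + (maxop (\<lambda>x. of_real (h3 x)) x + maxop (\<lambda>x. of_real (h4 x)) x)"
        unfolding maxop_cmult by simp
      finally show ?thesis .
    qed
    have cmod_sets: "{x. cmod (g x) > s} \<in> sets M"
    proof -
      have "{x \<in> space M. cmod (g x) > s} \<in> sets M" by measurable
      then show ?thesis by simp
    qed
    have sub: "{x. maxop g x > ennreal s \<or> cmod (g x) > s}
      \<subseteq> ((?big h1 \<union> ?big h2) \<union> (?big h3 \<union> ?big h4)) \<union> {x. cmod (g x) > s}"
    proof
      fix x assume x: "x \<in> {x. maxop g x > ennreal s \<or> cmod (g x) > s}"
      show "x \<in> ((?big h1 \<union> ?big h2) \<union> (?big h3 \<union> ?big h4)) \<union> {x. cmod (g x) > s}"
      proof (rule ccontr)
        assume n: "x \<notin> ((?big h1 \<union> ?big h2) \<union> (?big h3 \<union> ?big h4)) \<union> {x. cmod (g x) > s}"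
        then have "maxop g x \<le> (ennreal (2 * l) + ennreal (2 * l)) + (ennreal (2 * l) + ennreal (2 * l))"
          by (intro order_trans[OF maxop_le] add_mono) (auto simp: not_less)
        also have "\<dots> = ennreal s" using l unfolding s by (simp flip: ennreal_plus)
        finally show False using x n by auto
      qed
    qed
    have "emeasure M {x. maxop g x > ennreal s \<or> cmod (g x) > s}
      \<le> emeasure M (((?big h1 \<union> ?big h2) \<union> (?big h3 \<union> ?big h4)) \<union> {x. cmod (g x) > s})"
      by (intro emeasure_mono sub sets.Un big_sets m1 cmod_sets)
    also have "\<dots> \<le> ((emeasure M (?big h1) + emeasure M (?big h2)) + (emeasure M (?big h3) + emeasure M (?big h4)))
        + emeasure M {x. cmod (g x) > s}"
      by (intro order_trans[OF emeasure_subadditive] add_mono emeasure_subadditive order_refl sets.Un big_sets m1 cmod_sets)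
    also have "\<dots> \<le> ((ennreal D * ?Q + ennreal D * ?Q) + (ennreal D * ?Q + ennreal D * ?Q)) + ennreal (1 / s) * ?Q"
    proof (intro add_mono p1(2) p2(2) p3(2) p4(2))
      have "emeasure M {x. cmod (g x) > s} \<le> emeasure M {x \<in> space M. 1 \<le> ennreal (1 / s) * ennreal (cmod (g x))}"
      proof (rule emeasure_mono)
        show "{x. cmod (g x) > s} \<subseteq> {x \<in> space M. 1 \<le> ennreal (1 / s) * ennreal (cmod (g x))}"
          using \<open>0 < s\<close> by (auto simp flip: ennreal_mult simp: field_simps)
      qed measurable
      also have "\<dots> \<le> ennreal (1 / s) * (\<integral>\<^sup>+x. ennreal (cmod (g x)) * indicator (space M) x \<partial>M)"
        by (rule nn_integral_Markov_inequality) auto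
      also have "\<dots> \<le> ennreal (1 / s) * ?Q"
      proof (intro mult_left_mono nn_integral_mono)
        fix x
        have "cmod (g x) * 1 \<le> cmod (g x) * weight m (cmod (g x))"
          using weight_ge_1 \<open>m > 0\<close> by (intro mult_left_mono) auto
        then show "ennreal (cmod (g x)) * indicator (space M) x \<le> ennreal (cmod (g x) * weight m (cmod (g x)))"
          by (simp add: ennreal_leI)
      qed simp
      finally show "emeasure M {x. cmod (g x) > s} \<le> ennreal (1 / s) * ?Q" .
    qed
    also have "\<dots> = ennreal (4 * D + 1 / s) * ?Q"
    proof -
      have "ennreal (4 * D + 1 / s) = ((ennreal D + ennreal D) + (ennreal D + ennreal D)) + ennreal (1 / s)"
        using D(1) \<open>0 < s\<close> by (simp flip: ennreal_plus)
      then show ?thesis by (simp only: distrib_right)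
    qed
    finally show "emeasure M {x. maxop g x > ennreal s \<or> cmod (g x) > s} \<le> ennreal (4 * D + 1 / s) * ?Q" .
  qed
qed

subsection \<open>Convergence\<close>

text \<open>Nonnegativity of the variance of \<open>cmod (u x)\<close>; the total measure is
  1.\<close>

lemma integral_norm_le_sqrt:
  assumes "square_integrable M u"
  shows "(\<integral>x. cmod (u x) \<partial>M) \<le> sqrt (\<integral>x. (cmod (u x))\<^sup>2 \<partial>M)"
proof -
  have int: "integrable M (\<lambda>x. cmod (u x))" "integrable M (\<lambda>x. (cmod (u x))\<^sup>2)"
    using assms integrable_square_integrable[OF assms] by (auto simp: square_integrable_def)
  define t where "t = (\<integral>x. cmod (u x) \<partial>M)"
  have "0 \<le> (\<integral>x. (cmod (u x) - t)\<^sup>2 \<partial>M)" by simp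
  also have "\<dots> = (\<integral>x. (cmod (u x))\<^sup>2 - 2 * t * cmod (u x) + t\<^sup>2 \<partial>M)"
    by (simp add: power2_diff algebra_simps)
  also have "\<dots> = (\<integral>x. (cmod (u x))\<^sup>2 \<partial>M) - 2 * t * t + t\<^sup>2"
    using int by (simp add: t_def)
  finally have "t\<^sup>2 \<le> (\<integral>x. (cmod (u x))\<^sup>2 \<partial>M)" by (simp add: power2_eq_square)
  then show ?thesis unfolding t_def by (rule real_le_rsqrt)
qed

text \<open>Completeness is given as triviality of the orthogonal complement, so a limit has to be
  built first, as in Riesz-Fischer: an a.e. limit h of a subsequence, which turns out to have the
  coefficients of b and hence equals b a.e.\<close>

lemma psum_converges_L2:
  assumes b: "square_integrable M b"
  shows "(\<lambda>n. \<integral>x. (cmod (b x - psum n b x))\<^sup>2 \<partial>M) \<longlonglongrightarrow> 0"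
proof -
  define c where "c i = (cmod (coeff b i))\<^sup>2" for i
  have int_b: "integrable M b" by (rule integrable_square_integrable[OF b])
  have sum_c: "summable c"
    by (rule summableI_nonneg_bounded[of c]) (use bessel_inequality[OF b] in \<open>auto simp: c_def\<close>)
  \<comment> \<open>The tail of the Bessel series bounds the squared L2 distance from
    \<open>psum n b\<close> to every later partial sum.\<close>
  define T where "T n = suminf c - (\<Sum>i<n. c i)" for n
  have T_lim: "T \<longlonglongrightarrow> 0"
    unfolding T_def using tendsto_diff[OF tendsto_const summable_LIMSEQ[OF sum_c], of "suminf c"] by simp
  have T_nonneg: "T n \<ge> 0" for n
    unfolding T_def using sum_le_suminf[OF sum_c, of "{..<n}"] by (simp add: c_def)
  have T_mono: "T j \<le> T i" if "i \<le> j" for i j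
    unfolding T_def using that by (auto intro!: sum_mono2 simp: c_def)
  have dist_le: "(\<integral>x. (cmod (psum k b x - psum n b x))\<^sup>2 \<partial>M) \<le> T n" if "n \<le> k" for n k
  proof -
    have "psum n (psum k b) = psum n b" using that by (auto simp: psum_def coeff_psum)
    then have "(\<integral>x. (cmod (psum k b x - psum n b x))\<^sup>2 \<partial>M) = (\<integral>x. (cmod (psum k b x))\<^sup>2 \<partial>M) - (\<Sum>i<n. c i)"
      using integral_norm_diff_psum[OF square_integrable_psum, of k b n] that by (simp add: coeff_psum c_def)
    also have "(\<integral>x. (cmod (psum k b x))\<^sup>2 \<partial>M) = (\<Sum>i<k. c i)"
      using integral_norm_diff_psum[OF square_integrable_psum, of k b k] by (simp add: coeff_psum c_def psum_psum)
    also have "\<dots> - (\<Sum>i<n. c i) \<le> T n"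
      unfolding T_def using sum_le_suminf[OF sum_c, of "{..<k}"] by (simp add: c_def)
    finally show ?thesis .
  qed
  have L1: "(\<integral>x. cmod (psum k b x - psum n b x) \<partial>M) \<le> sqrt (T n)" if "n \<le> k" for n k
    by (rule order_trans[OF integral_norm_le_sqrt[OF square_integrable_diff]])
      (use dist_le[OF that] in auto)
  have "\<exists>N. \<forall>i\<ge>N. \<forall>j\<ge>N. (\<integral>x. cmod (psum i b x - psum j b x) \<partial>M) < e" if "e > 0" for e
  proof -
    obtain N where N: "T N < e\<^sup>2"
      using order_tendstoD(2)[OF T_lim, of "e\<^sup>2"] \<open>e > 0\<close> by (auto simp: eventually_sequentially)
    have "(\<integral>x. cmod (psum i b x - psum j b x) \<partial>M) < e" if "i \<ge> N" "j \<ge> N" for i j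
    proof -
      have "(\<integral>x. cmod (psum i b x - psum j b x) \<partial>M) \<le> sqrt (T (min i j))"
        using L1[of i j] L1[of j i] by (cases "i \<le> j") (auto simp: norm_minus_commute min_def)
      also have "\<dots> \<le> sqrt (T N)" using T_mono[of N "min i j"] that by simp
      also have "\<dots> < e" using N \<open>e > 0\<close> by (intro real_less_lsqrt T_nonneg) auto
      finally show ?thesis .
    qed
    then show ?thesis by blast
  qed
  then obtain r where r: "strict_mono r" "AE x in M. Cauchy (\<lambda>i. psum (r i) b x)"
    by (rule cauchy_L1_AE_cauchy_subseq[of M "\<lambda>n. psum n b", OF integrable_psum])
  define h where "h x = lim (\<lambda>i. psum (r i) b x)" for x
  have [measurable]: "h \<in> borel_measurable M"
    unfolding h_def by (rule borel_measurable_lim_metric) measurable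
  have [measurable]: "b \<in> borel_measurable M" using int_b by simp
  have lim_h: "AE x in M. (\<lambda>i. psum (r i) b x) \<longlonglongrightarrow> h x"
    using r(2) by eventually_elim (simp add: h_def Cauchy_convergent_iff convergent_LIMSEQ_iff)
  \<comment> \<open>Fatou along the subsequence reaches every \<open>psum n b\<close>, not only
    those of the subsequence.\<close>
  have fatou: "(\<integral>\<^sup>+x. ennreal ((cmod (h x - psum n b x))\<^sup>2) \<partial>M) \<le> ennreal (T n)" for n
  proof -
    let ?u = "\<lambda>i x. ennreal ((cmod (psum (r i) b x - psum n b x))\<^sup>2)"
    have "(\<integral>\<^sup>+x. ennreal ((cmod (h x - psum n b x))\<^sup>2) \<partial>M) = (\<integral>\<^sup>+x. liminf (\<lambda>i. ?u i x) \<partial>M)"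
    proof (rule nn_integral_cong_AE)
      show "AE x in M. ennreal ((cmod (h x - psum n b x))\<^sup>2) = liminf (\<lambda>i. ?u i x)"
        using lim_h
      proof eventually_elim
        case (elim x)
        then have "(\<lambda>i. ?u i x) \<longlonglongrightarrow> ennreal ((cmod (h x - psum n b x))\<^sup>2)"
          by (intro tendsto_intros)
        then show ?case by (intro lim_imp_Liminf[symmetric]) simp_all
      qed
    qed
    also have "\<dots> \<le> liminf (\<lambda>i. \<integral>\<^sup>+x. ?u i x \<partial>M)"
      by (rule nn_integral_liminf) measurable
    also have "\<dots> \<le> limsup (\<lambda>i. \<integral>\<^sup>+x. ?u i x \<partial>M)"
      by (rule Liminf_le_Limsup) simp
    also have "\<dots> \<le> ennreal (T n)"
    proof (rule Limsup_bounded)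
      show "\<forall>\<^sub>F i in sequentially. (\<integral>\<^sup>+x. ?u i x \<partial>M) \<le> ennreal (T n)"
        using eventually_ge_at_top[of n]
      proof eventually_elim
        case (elim i)
        then have "n \<le> r i" using seq_suble[OF r(1), of i] by simp
        have "square_integrable M (\<lambda>x. psum (r i) b x - psum n b x)"
          by (intro square_integrable_diff square_integrable_psum)
        then have "(\<integral>\<^sup>+x. ?u i x \<partial>M) = ennreal (\<integral>x. (cmod (psum (r i) b x - psum n b x))\<^sup>2 \<partial>M)"
          by (intro nn_integral_eq_integral) (auto simp: square_integrable_def)
        also have "\<dots> \<le> ennreal (T n)" by (intro ennreal_leI dist_le \<open>n \<le> r i\<close>)
        finally show ?case .
      qed
    qed
    finally show ?thesis .
  qed
  have sq: "square_integrable M (\<lambda>x. h x - psum n b x)" for n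
    unfolding square_integrable_def
  proof
    show "integrable M (\<lambda>x. (cmod (h x - psum n b x))\<^sup>2)"
      by (rule integrableI_nonneg) (use fatou[of n] in \<open>auto simp: le_less_trans ennreal_less_top\<close>)
  qed measurable
  \<comment> \<open>For n = 0 the partial sum is 0.\<close>
  have sq_h: "square_integrable M h"
    using sq[of 0] by (simp add: psum_def)
  have int_h: "integrable M h" by (rule integrable_square_integrable[OF sq_h])
  have h_le: "(\<integral>x. (cmod (h x - psum n b x))\<^sup>2 \<partial>M) \<le> T n" for n
  proof -
    have "ennreal (\<integral>x. (cmod (h x - psum n b x))\<^sup>2 \<partial>M) \<le> ennreal (T n)"
      using fatou[of n] sq[of n] by (subst nn_integral_eq_integral[symmetric]) (auto simp: square_integrable_def)
    then show ?thesis using T_nonneg by (simp add: ennreal_le_iff)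
  qed
  have coeff_h: "coeff h i = coeff b i" for i
  proof -
    \<comment> \<open>For n > i the i-th coefficient of \<open>psum n b\<close> is already that of
      b, and coefficients are continuous in L1.\<close>
    have "cmod (coeff h i - coeff b i) \<le> sqrt (T n)" if "n > i" for n
    proof -
      have "coeff h i - coeff b i = coeff (\<lambda>x. h x - psum n b x) i"
        using that int_h by (simp add: coeff_diff coeff_psum)
      also have "cmod \<dots> \<le> (\<integral>x. cmod (h x - psum n b x) \<partial>M)" by (rule norm_coeff_le)
      also have "\<dots> \<le> sqrt (T n)"
        by (rule order_trans[OF integral_norm_le_sqrt[OF sq]]) (use h_le in auto)
      finally show ?thesis .
    qed
    moreover have "(\<lambda>n. sqrt (T n)) \<longlonglongrightarrow> 0" using tendsto_real_sqrt[OF T_lim] by simp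
    ultimately have "cmod (coeff h i - coeff b i) \<le> 0"
      by (intro LIMSEQ_le_const[of "\<lambda>n. sqrt (T n)"]) (auto intro: exI[of _ "Suc i"])
    then show ?thesis by simp
  qed
  have "square_integrable M (\<lambda>x. b x - h x)" by (intro square_integrable_diff b sq_h)
  moreover have "(\<integral>x. (b x - h x) * cnj (\<xi> i x) \<partial>M) = 0" for i
    using coeff_diff[OF int_b int_h, of i] coeff_h by (simp add: coeff_def)
  ultimately have "AE x in M. b x - h x = 0"
    using complete unfolding complete_orthonormal_system_def by blast
  then have "(\<integral>x. (cmod (b x - psum n b x))\<^sup>2 \<partial>M) = (\<integral>x. (cmod (h x - psum n b x))\<^sup>2 \<partial>M)" for n
    by (intro integral_cong_AE) auto
  then have le: "(\<integral>x. (cmod (b x - psum n b x))\<^sup>2 \<partial>M) \<le> T n" for n using h_le by simp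
  show ?thesis
    by (rule tendsto_sandwich[OF _ _ tendsto_const T_lim]) (auto simp: le intro!: always_eventually)
qed

text \<open>Order of choices: s, then D depending on s, then the cut A and the length n, making both
  weighted integrals smaller than \<epsilon> / (2 D). In f = g + u + \<open>psum n b\<close> the
  last term reproduces itself for j \<ge> n and cancels, so outside two bad sets, each of measure at
  most \<epsilon> / 2, four terms of size s remain.\<close>

lemma weighted_converges_ae:
  fixes f :: "'a \<Rightarrow> real"
  assumes H: "fourier_maximal M \<xi> \<in> H_class m M" and "m > 0"
    and f_meas [measurable]: "f \<in> borel_measurable M"
    and f_weight: "(\<integral>\<^sup>+x. ennreal (\<bar>f x\<bar> * weight m \<bar>f x\<bar>) \<partial>M) < \<infinity>"
  shows "AE x in M. (\<lambda>j. psum j (\<lambda>x. of_real (f x)) x) \<longlonglongrightarrow> of_real (f x)"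
proof -
  let ?f = "\<lambda>x. complex_of_real (f x)"
  define Q where "Q g = (\<integral>\<^sup>+x. ennreal (cmod (g x) * weight m (cmod (g x))) \<partial>M)" for g :: "'a \<Rightarrow> complex"
  obtain C where C: "C > 0" "\<And>t. t \<ge> 0 \<Longrightarrow> weight m t \<le> C * (1 + t)"
    using weight_le_linear[OF \<open>m > 0\<close>] by blast
  have le_weight: "\<bar>t\<bar> \<le> \<bar>t\<bar> * weight m \<bar>t\<bar>" for t
    using mult_left_mono[OF weight_ge_1[of m "\<bar>t\<bar>"], of "\<bar>t\<bar>"] \<open>m > 0\<close> by simp
  have int_f: "integrable M f"
  proof (rule integrableI_bounded)
    have "(\<integral>\<^sup>+x. ennreal (norm (f x)) \<partial>M) \<le> (\<integral>\<^sup>+x. ennreal (\<bar>f x\<bar> * weight m \<bar>f x\<bar>) \<partial>M)"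
      using le_weight by (intro nn_integral_mono ennreal_leI) simp
    then show "(\<integral>\<^sup>+x. ennreal (norm (f x)) \<partial>M) < \<infinity>" using f_weight by (rule le_less_trans)
  qed measurable
  have tail: "\<exists>n. Q (\<lambda>x. if \<bar>f x\<bar> > real n then ?f x else 0) < ennreal \<epsilon>" if "\<epsilon> > 0" for \<epsilon>
  proof -
    have "(\<lambda>n. Q (\<lambda>x. if \<bar>f x\<bar> > real n then ?f x else 0)) \<longlonglongrightarrow> (\<integral>\<^sup>+x. 0 \<partial>M)"
      unfolding Q_def
    proof (rule nn_integral_dominated_convergence[where w="\<lambda>x. ennreal (\<bar>f x\<bar> * weight m \<bar>f x\<bar>)"])
      show "AE x in M. (\<lambda>n. ennreal (cmod (if \<bar>f x\<bar> > real n then ?f x else 0)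
          * weight m (cmod (if \<bar>f x\<bar> > real n then ?f x else 0)))) \<longlonglongrightarrow> 0"
      proof (intro AE_I2 tendsto_eventually)
        fix x
        obtain n0 where n0: "\<bar>f x\<bar> < real n0" using reals_Archimedean2 by blast
        show "\<forall>\<^sub>F n in sequentially. ennreal (cmod (if \<bar>f x\<bar> > real n then ?f x else 0)
          * weight m (cmod (if \<bar>f x\<bar> > real n then ?f x else 0))) = 0"
          using eventually_ge_at_top[of n0] by eventually_elim (use n0 in auto)
      qed
      show "AE x in M. ennreal (cmod (if \<bar>f x\<bar> > real n then ?f x else 0)
          * weight m (cmod (if \<bar>f x\<bar> > real n then ?f x else 0))) \<le> ennreal (\<bar>f x\<bar> * weight m \<bar>f x\<bar>)" for n
        by (intro AE_I2) auto
    qed (use f_weight in auto)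
    then have "\<forall>\<^sub>F n in sequentially. Q (\<lambda>x. if \<bar>f x\<bar> > real n then ?f x else 0) < ennreal \<epsilon>"
      by (rule order_tendstoD) (use that in simp)
    then show ?thesis by (auto simp: eventually_sequentially)
  qed
  have L2: "\<exists>n. Q (\<lambda>x. b x - psum n b x) < ennreal \<epsilon>" if b: "square_integrable M b" and "\<epsilon> > 0" for b \<epsilon>
  proof -
    define I where "I n = (\<integral>x. (cmod (b x - psum n b x))\<^sup>2 \<partial>M)" for n
    have "I \<longlonglongrightarrow> 0" unfolding I_def by (rule psum_converges_L2[OF b])
    then have "(\<lambda>n. C * (sqrt (I n) + I n)) \<longlonglongrightarrow> C * (sqrt 0 + 0)"
      by (intro tendsto_intros)
    then have "\<forall>\<^sub>F n in sequentially. C * (sqrt (I n) + I n) < \<epsilon>"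
      by (rule order_tendstoD) (use that in simp)
    then obtain n where n: "C * (sqrt (I n) + I n) < \<epsilon>" by (auto simp: eventually_sequentially)
    have sq: "square_integrable M (\<lambda>x. b x - psum n b x)"
      by (intro square_integrable_diff b square_integrable_psum)
    let ?u = "\<lambda>x. cmod (b x - psum n b x)"
    have int: "integrable M ?u" "integrable M (\<lambda>x. (?u x)\<^sup>2)"
      using sq integrable_square_integrable[OF sq] by (auto simp: square_integrable_def)
    have "Q (\<lambda>x. b x - psum n b x) \<le> (\<integral>\<^sup>+x. ennreal (C * (?u x + (?u x)\<^sup>2)) \<partial>M)"
      unfolding Q_def
    proof (intro nn_integral_mono ennreal_leI)
      fix x
      have "?u x * weight m (?u x) \<le> ?u x * (C * (1 + ?u x))" by (intro mult_left_mono C(2)) auto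
      then show "?u x * weight m (?u x) \<le> C * (?u x + (?u x)\<^sup>2)"
        by (simp add: power2_eq_square algebra_simps)
    qed
    also have "\<dots> = ennreal (\<integral>x. C * (?u x + (?u x)\<^sup>2) \<partial>M)"
      using int C(1) by (intro nn_integral_eq_integral) auto
    also have "(\<integral>x. C * (?u x + (?u x)\<^sup>2) \<partial>M) = C * ((\<integral>x. ?u x \<partial>M) + I n)"
      using int by (simp add: I_def)
    also have "\<dots> \<le> C * (sqrt (I n) + I n)"
      using C(1) integral_norm_le_sqrt[OF sq] unfolding I_def by (intro mult_left_mono add_right_mono) auto
    finally have "Q (\<lambda>x. b x - psum n b x) \<le> ennreal (C * (sqrt (I n) + I n))" by (simp add: ennreal_leI)
    then show ?thesis using n that(2) by (auto intro!: exI[of _ n] elim!: le_less_trans simp: ennreal_less_iff ennreal_lessI)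
  qed
  have small: "AE x in M. \<exists>N. \<forall>j\<ge>N. cmod (psum j ?f x - ?f x) \<le> 4 * s" if s: "0 < s" "s \<le> 1" for s
  proof -
    obtain D where D: "D > 0" "\<And>g :: 'a \<Rightarrow> complex. integrable M g \<Longrightarrow>
        emeasure M {x. maxop g x > ennreal s \<or> cmod (g x) > s} \<le> ennreal D * Q g"
      using weighted_bound[OF H \<open>m > 0\<close> s] unfolding Q_def by blast
    define Z where "Z = {x \<in> space M. \<not> (\<exists>N. \<forall>j\<ge>N. cmod (psum j ?f x - ?f x) \<le> 4 * s)}"
    have Z_sets [measurable]: "Z \<in> sets M" unfolding Z_def by measurable
    \<comment> \<open>The set Z does not depend on A and n, so its measure is below every
      \<epsilon>; the summand 0 fits \<open>field_le_epsilon\<close>.\<close>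
    have "measure M Z \<le> 0 + \<epsilon>" if "\<epsilon> > 0" for \<epsilon>
    proof -
      define \<delta> where "\<delta> = \<epsilon> / (2 * D)"
      have \<delta>: "\<delta> > 0" using \<open>\<epsilon> > 0\<close> D(1) by (simp add: \<delta>_def)
      obtain A where A: "Q (\<lambda>x. if \<bar>f x\<bar> > real A then ?f x else 0) < ennreal \<delta>"
        using tail[OF \<delta>] by blast
      define g where "g x = (if \<bar>f x\<bar> > real A then ?f x else 0)" for x
      define b where "b x = (if \<bar>f x\<bar> > real A then 0 else ?f x)" for x
      have [measurable]: "g \<in> borel_measurable M" "b \<in> borel_measurable M"
        unfolding g_def b_def by measurable
      have b: "square_integrable M b"
        by (rule square_integrable_bounded[where B="real A"]) (auto simp: b_def)
      have int_b: "integrable M b" by (rule integrable_square_integrable[OF b])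
      obtain n where n: "Q (\<lambda>x. b x - psum n b x) < ennreal \<delta>" using L2[OF b \<delta>] by blast
      define u where "u x = b x - psum n b x" for x
      have int_u: "integrable M u" unfolding u_def using int_b by simp
      have int_g: "integrable M g"
        by (rule Bochner_Integration.integrable_bound[OF int_f]) (auto simp: g_def)
      let ?bad = "\<lambda>g. {x. maxop g x > ennreal s \<or> cmod (g x) > s}"
      have bad_sets: "?bad g \<in> sets M" if [measurable]: "g \<in> borel_measurable M" for g
      proof -
        have "{x \<in> space M. maxop g x > ennreal s \<or> cmod (g x) > s} \<in> sets M" by measurable
        then show ?thesis by simp
      qed
      have f_split: "?f = (\<lambda>x. (g x + u x) + psum n b x)"
        by (auto simp: g_def u_def b_def)
      have sub: "Z \<subseteq> ?bad g \<union> ?bad u"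
      proof (rule ccontr)
        assume "\<not> Z \<subseteq> ?bad g \<union> ?bad u"
        then obtain x where "x \<in> Z" "x \<notin> ?bad g" "x \<notin> ?bad u" by blast
        then have x: "x \<in> Z" "\<not> maxop g x > ennreal s" "cmod (g x) \<le> s"
          "\<not> maxop u x > ennreal s" "cmod (u x) \<le> s" by (simp_all add: not_less)
        have "cmod (psum j ?f x - ?f x) \<le> 4 * s" if "j \<ge> n" for j
        proof -
          have "psum j ?f x = psum j g x + psum j u x + psum n b x"
            unfolding f_split using int_g int_u that by (simp add: psum_add psum_psum)
          moreover have "?f x = g x + u x + psum n b x" using fun_cong[OF f_split, of x] by simp
          ultimately have "psum j ?f x - ?f x = (psum j g x - g x) + (psum j u x - u x)" by simp
          also have "cmod \<dots> \<le> (cmod (psum j g x) + cmod (g x)) + (cmod (psum j u x) + cmod (u x))"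
            by (intro norm_triangle_le add_mono norm_triangle_ineq4)
          also have "\<dots> \<le> (s + s) + (s + s)"
            using x s by (intro add_mono) (auto simp: maxop_gt_iff not_less)
          finally show ?thesis by simp
        qed
        then show False using x(1) unfolding Z_def by blast
      qed
      have "emeasure M Z \<le> emeasure M (?bad g \<union> ?bad u)"
        by (intro emeasure_mono sub sets.Un bad_sets borel_measurable_integrable int_g int_u)
      also have "\<dots> \<le> emeasure M (?bad g) + emeasure M (?bad u)"
        by (intro emeasure_subadditive bad_sets borel_measurable_integrable int_g int_u)
      also have "\<dots> \<le> ennreal D * Q g + ennreal D * Q u"
        by (intro add_mono D(2) int_g int_u)
      also have "\<dots> \<le> ennreal D * ennreal \<delta> + ennreal D * ennreal \<delta>"
        using A n unfolding g_def[abs_def] u_def[abs_def] by (intro add_mono mult_left_mono) auto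
      also have "\<dots> = ennreal \<epsilon>"
        using D(1) \<delta> \<open>\<epsilon> > 0\<close> by (simp add: \<delta>_def flip: ennreal_mult ennreal_plus)
      finally show ?thesis using \<open>\<epsilon> > 0\<close> by (simp add: emeasure_eq_measure)
    qed
    then have "measure M Z \<le> 0" by (rule field_le_epsilon)
    then have "emeasure M Z = 0" by (simp add: emeasure_eq_measure measure_le_0_iff)
    then show ?thesis
      by (rule AE_I[OF _ _ Z_sets, rotated]) (auto simp: Z_def)
  qed
  \<comment> \<open>The thresholds 1 / (k + 1) stay in (0, 1] and tend to 0, at the cost of
    countably many null sets.\<close>
  have "AE x in M. \<forall>k. \<exists>N. \<forall>j\<ge>N. cmod (psum j ?f x - ?f x) \<le> 4 * (1 / real (Suc k))"
    unfolding AE_all_countable by (intro allI small) auto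
  then show ?thesis
  proof eventually_elim
    case (elim x)
    show ?case
    proof (rule LIMSEQ_I)
      fix e :: real assume "e > 0"
      obtain k where "4 / e < real k" using reals_Archimedean2 by blast
      then have k: "4 * (1 / real (Suc k)) < e" using \<open>e > 0\<close> by (simp add: field_simps)
      from elim obtain N where "\<forall>j\<ge>N. cmod (psum j ?f x - ?f x) \<le> 4 * (1 / real (Suc k))" by blast
      then show "\<exists>N. \<forall>j\<ge>N. norm (psum j ?f x - ?f x) < e" using k by (meson le_less_trans)
    qed
  qed
qed

end

section \<open>From the logarithmic class to the weighted condition\<close>

lemma LlogL_integrand_measurable [measurable]: "LlogL_integrand m \<in> borel_measurable borel"
  unfolding LlogL_integrand_def Let_def by measurable

theorem theorem2:
  fixes M :: "'a::{topological_ab_group_add, t2_space} measure"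
    and \<xi> :: "nat \<Rightarrow> 'a \<Rightarrow> complex"
    and m :: real
  assumes "compact (UNIV :: 'a set)"
    and "haar_measure M"
    and "\<And>j. group_character (\<xi> j)"
    and "complete_orthonormal_system M \<xi>"
    and "m > 0"
    and "fourier_maximal M \<xi> \<in> H_class m M"
  shows "\<forall>f \<in> LlogL_logloglogL_class m M. fourier_converges_ae M \<xi> f"
proof
  fix f assume f: "f \<in> LlogL_logloglogL_class m M"
  interpret haar_fourier M \<xi> by (unfold_locales) (fact assms)+
  have [measurable]: "f \<in> borel_measurable M" and fin: "(\<integral>\<^sup>+x. LlogL_integrand m \<bar>f x\<bar> \<partial>M) < \<infinity>"
    using f by (auto simp: LlogL_logloglogL_class_def)
  \<comment> \<open>The integrand is \<infinity> at \<infinity>, so a finite integral already forces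
    f to be finite a.e.\<close>
  have "AE x in M. LlogL_integrand m \<bar>f x\<bar> \<noteq> \<infinity>"
    by (rule nn_integral_PInf_AE) (use fin in auto)
  then have finite_f: "AE x in M. \<bar>f x\<bar> \<noteq> \<infinity>"
    by eventually_elim (auto simp: LlogL_integrand_def)
  obtain C where C: "C > 0" "\<And>t. t \<le> 16 \<Longrightarrow> weight m t \<le> C"
    "\<And>t. t > 16 \<Longrightarrow> weight m t \<le> C * (log_plus t powr m * log_plus (log_plus (log_plus t)))"
    using weight_le[OF \<open>m > 0\<close>] by blast
  let ?g = "\<lambda>x. real_of_ereal (f x)"
  \<comment> \<open>The summand 16 pays for small values, where the class integrand may vanish
    although the weight does not; it is integrable as the measure is finite.\<close>
  have "AE x in M. ennreal (\<bar>?g x\<bar> * weight m \<bar>?g x\<bar>) \<le> ennreal C * (ennreal 16 + LlogL_integrand m \<bar>f x\<bar>)"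
    using finite_f
  proof eventually_elim
    case (elim x)
    define t where "t = \<bar>?g x\<bar>"
    have t: "t \<ge> 0" "real_of_ereal \<bar>f x\<bar> = t" by (cases "f x"; simp add: t_def)+
    let ?L = "log_plus t powr m * log_plus (log_plus (log_plus t))"
    have L: "?L \<ge> 0" by simp
    have "t * weight m t \<le> C * (16 + t * ?L)"
    proof (cases "t \<le> 16")
      case True
      have "t * weight m t \<le> 16 * C"
        using True t C(1) C(2)[OF True] weight_ge_1[of m t] \<open>m > 0\<close> by (intro mult_mono) auto
      also have "\<dots> \<le> C * (16 + t * ?L)"
        using C(1) t L by (simp add: distrib_left)
      finally show ?thesis .
    next
      case False
      have "t * weight m t \<le> t * (C * ?L)" using False t by (intro mult_left_mono C(3)) auto
      also have "\<dots> \<le> C * (16 + t * ?L)" using C(1) by (simp add: distrib_left mult_ac)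
      finally show ?thesis .
    qed
    then have "ennreal (t * weight m t) \<le> ennreal C * (ennreal 16 + ennreal (t * ?L))"
      using C(1) t L by (simp add: ennreal_leI flip: ennreal_mult ennreal_plus del: ennreal_numeral)
    moreover have "LlogL_integrand m \<bar>f x\<bar> = ennreal (t * ?L)"
      using elim t by (simp add: LlogL_integrand_def Let_def mult.assoc)
    ultimately show ?case by (simp add: t_def)
  qed
  then have "(\<integral>\<^sup>+x. ennreal (\<bar>?g x\<bar> * weight m \<bar>?g x\<bar>) \<partial>M)
      \<le> (\<integral>\<^sup>+x. ennreal C * (ennreal 16 + LlogL_integrand m \<bar>f x\<bar>) \<partial>M)"
    by (rule nn_integral_mono_AE)
  also have "\<dots> = ennreal C * (ennreal 16 * emeasure M (space M) + (\<integral>\<^sup>+x. LlogL_integrand m \<bar>f x\<bar> \<partial>M))"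
    by (subst nn_integral_cmult, measurable, subst nn_integral_add) auto
  also have "\<dots> < \<infinity>"
    using fin by (simp add: emeasure_eq_measure ennreal_mult_eq_top_iff less_top[symmetric])
  finally have "AE x in M. (\<lambda>j. psum j (\<lambda>x. of_real (?g x)) x) \<longlonglongrightarrow> of_real (?g x)"
    by (intro weighted_converges_ae[OF assms(6) \<open>m > 0\<close>]) measurable
  then show "fourier_converges_ae M \<xi> f"
    unfolding fourier_converges_ae_def fourier_partial_sum_eq using finite_f by eventually_elim simp
qed

end
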